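(* Assume (A1), and assume (C3) holds for some $p>2$. Let $a>0$ and set $$v_n=\frac{n^a}{(nh_n)^{d/2}},\qquad \theta=\frac{2a(d+p)-d^2}{d(3d+2)}.$$ If $\theta>0$ and $h_n\ge n^{-\theta}$ for all $n$, then $$\Big\|\sup_{x\in[0,1]^d}|g_n(x)-Eg_n(x)|\Big\|_p=O[v_n],$$ where $\|\cdot\|_p$ is the $L^p(\mathbb P)$ norm and $O[\cdot]$ is the usual deterministic big-O as $n\to\infty$.
   Context: Fix an integer $d\ge1$. For $x=(x_1,\dots,x_d)\in\mathbb{R}^d$ let $\|x\|=\max_{1\le k\le d}|x_k|$; for $i,j\in\mathbb{Z}^d$ let $|i-j|=\max_{1\le l\le d}|i_l-j_l|$, and $|k|=|k-0|$. Let $(\varepsilon_i)_{i\in\mathbb{Z}^d}$ be a strictly stationary real random field on a probability space $(\Omega,\mathcal F,\mathbb P)$ with $E\varepsilon_0=0$. Strict stationarity means: for all $k\in\mathbb{Z}^d$, $n\ge1$ and $i_1,\dots,i_n\in\mathbb{Z}^d$, the vectors $(\varepsilon_{i_1},\dots,\varepsilon_{i_n})$ and $(\varepsilon_{i_1+k},\dots,\varepsilon_{i_n+k})$ have the same law. Let $g:[0,1]^d\to\mathbb{R}$ and $\Lambda_n=\{1,\dots,n\}^d$, and set $Y_i=g(i/n)+\varepsilon_i$ for $i\in\Lambda_n$. Let $K$ be a probability density on $\mathbb{R}^d$ and $(h_n)_{n\ge1}$ positive numbers with $h_n\to0$ and $nh_n\to\infty$. For $x\in[0,1]^d$ define $$g_n(x)=\frac{\sum_{i\in\Lambda_n}Y_i\,K\big((x-i/n)/h_n\big)}{\sum_{i\in\Lambda_n}K\big((x-i/n)/h_n\big)}.$$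 Assumption (A1): $K$ is symmetric and nonnegative, and supported in $[-1,1]^d$. There is $\eta>0$ with $|K(x)-K(y)|\le\eta\|x-y\|$ for all $x,y\in[-1,1]^d$, and there are constants $c,C>0$ with $c\le K(x)\le C$ for all $x\in[-1,1]^d$. Dependence notation: $i<_{lex}j$ for distinct $i,j\in\mathbb{Z}^d$ means either $i_1<j_1$, or for some $p\in\{2,\dots,d\}$ one has $i_p<j_p$ and $i_q=j_q$ for $1\le q<p$. Set $V_i^1=\{j\in\mathbb{Z}^d: j<_{lex}i\}$ and, for integers $m\ge2$, $V_i^m=V_i^1\cap\{j:|i-j|\ge m\}$. For $\Gamma\subset\mathbb{Z}^d$ let $\mathcal F_\Gamma=\sigma(\varepsilon_j: j\in\Gamma)$. For $k\in V_0^1$ (so $|k|\ge1$) put $E_{|k|}(\varepsilon_0)=E(\varepsilon_0\mid\mathcal F_{V_0^{|k|}})$. Condition (C3) (for a given $p>2$): $\varepsilon_0\in L^p$ and $\sum_{k\in V_0^1}\|\varepsilon_kE_{|k|}(\varepsilon_0)\|_{p/2}<\infty$. *)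

theory Defs
  imports "HOL-Probability.Probability"
begin

text \<open>Indices of the random field are vectors of integers indexed by a finite, linearly
ordered type 'd of coordinates, so d = CARD('d). Points are real vectors (real, 'd) vec.\<close>

definition maxnorm :: "(real, 'd::finite) vec \<Rightarrow> real" where
  "maxnorm x = Max (range (\<lambda>k. \<bar>x $ k\<bar>))"

definition imax :: "(int, 'd::finite) vec \<Rightarrow> int" where
  "imax k = Max (range (\<lambda>l. \<bar>k $ l\<bar>))"

definition lex_less :: "(int, 'd::{finite,linorder}) vec \<Rightarrow> (int, 'd) vec \<Rightarrow> bool" where
  "lex_less i j \<longleftrightarrow> (\<exists>q. i $ q < j $ q \<and> (\<forall>r. r < q \<longrightarrow> i $ r = j $ r))"

text \<open>V i m = V_i^m (for m = 1 this is V_i^1, since distinct indices have distance \<ge> 1).\<close>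
definition Vset :: "(int, 'd::{finite,linorder}) vec \<Rightarrow> int \<Rightarrow> ((int, 'd) vec) set" where
  "Vset i m = {j. lex_less j i \<and> imax (i - j) \<ge> m}"

definition Fsig :: "'a measure \<Rightarrow> ('i \<Rightarrow> 'a \<Rightarrow> real) \<Rightarrow> 'i set \<Rightarrow> 'a measure" where
  "Fsig M eps \<Gamma> = sigma (space M) (\<Union>j\<in>\<Gamma>. {eps j -` B \<inter> space M | B. B \<in> sets borel})"

definition Lpnorm :: "'a measure \<Rightarrow> real \<Rightarrow> ('a \<Rightarrow> real) \<Rightarrow> ennreal" where
  "Lpnorm M q X = (let I = (\<integral>\<^sup>+ \<omega>. ennreal (\<bar>X \<omega>\<bar> powr q) \<partial>M) in
     if I = \<infinity> then \<infinity> else ennreal (enn2real I powr (1 / q)))"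

definition ivec :: "(int, 'd::finite) vec \<Rightarrow> (real, 'd) vec" where
  "ivec i = (\<chi> l. real_of_int (i $ l))"

definition Lam :: "nat \<Rightarrow> ((int, 'd::finite) vec) set" where
  "Lam n = {i. \<forall>l. 1 \<le> i $ l \<and> i $ l \<le> int n}"

definition unit_cube :: "((real, 'd::finite) vec) set" where
  "unit_cube = {x. \<forall>l. 0 \<le> x $ l \<and> x $ l \<le> 1}"

definition gn :: "((real, 'd::finite) vec \<Rightarrow> real) \<Rightarrow> ((int, 'd) vec \<Rightarrow> 'a \<Rightarrow> real)
    \<Rightarrow> ((real, 'd) vec \<Rightarrow> real) \<Rightarrow> (nat \<Rightarrow> real) \<Rightarrow> nat \<Rightarrow> (real, 'd) vec \<Rightarrow> 'a \<Rightarrow> real" where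
  "gn g eps K h n x \<omega> =
     (\<Sum>i\<in>Lam n. (g ((1 / real n) *\<^sub>R ivec i) + eps i \<omega>) * K ((1 / h n) *\<^sub>R (x - (1 / real n) *\<^sub>R ivec i)))
     / (\<Sum>i\<in>Lam n. K ((1 / h n) *\<^sub>R (x - (1 / real n) *\<^sub>R ivec i)))"

end

theory Submission
  imports Defs "HOL-Real_Asymp.Real_Asymp"
begin

text \<open>
  After centring, the numerator of the estimator is \<open>\<Sum>i. \<epsilon>\<^sub>i K ((x - i / n) / h)\<close> and the denominator is of
  order \<open>(n h) ^ d\<close>.

  Under (C3), every weighted sum with weights bounded by 1 over a finite set \<open>\<Gamma>\<close> has \<open>p\<close>-th moment at
  most \<open>(D |\<Gamma>|) powr (p / 2)\<close>: expand \<open>|S|\<^sup>p\<close> to second order along the lexicographic order, and telescope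
  the first-order term at site \<open>i\<close> by deleting the sites preceding \<open>i\<close>, nearest first.

  The function \<open>i \<mapsto> K ((x - i / n) / h)\<close> is a Lipschitz weight times the indicator of a box. Replacing \<open>x\<close> by
  the nearest point of a grid of mesh \<open>n powr - \<kappa>\<close> in the weight only costs a multiple of \<open>\<Sum>|\<epsilon>\<^sub>i|\<close>.
  The boxes are not discretised: a dyadic decomposition in each coordinate (Rademacher--Menshov) bounds
  the sums over all boxes at once, at the price of powers of \<open>log n\<close>. The supremum over the grid costs a factor
  \<open>n powr (d \<kappa> / p)\<close>, and the choice of \<open>\<theta>\<close> allows a \<open>\<kappa>\<close> with \<open>d \<kappa> < a p\<close>, which leaves room for
  the logarithms.
\<close>

section \<open>Elementary inequalities\<close>

text \<open>Being bounded below on the cube, \<open>K\<close> jumps at its boundary: a small move of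
  \<open>x\<close> changes which sites enter the sum, and no Lipschitz estimate controls this. Hence
  the split into weight and box. The dyadic boxes are anchored at a corner attached to each grid
  point and fill a cube of side comparable to \<open>n h\<close>, not \<open>n\<close>; this keeps
  their moments at the order of \<open>(n h) ^ d\<close> raised to \<open>p / 2\<close>. The mesh
  must be at most \<open>h\<close>, and freezing the weight must cost no more than the rate; both
  bound \<open>\<kappa>\<close> from below, while the size of the grid asks for
  \<open>d * \<kappa> < a * p\<close>. For the second demand this means
  \<open>d * \<theta> * (d + 2) < 2 * a * (d + p) - d\<^sup>2\<close>. The right side equals
  \<open>d * \<theta> * (3 * d + 2)\<close>, so the inequality is strict.\<close>

definition spow :: "real \<Rightarrow> real \<Rightarrow> real" where
  "spow q x = sgn x * \<bar>x\<bar> powr q"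

lemma abs_spow: "\<bar>spow q x\<bar> = \<bar>x\<bar> powr q"
  by (auto simp: spow_def abs_mult sgn_if)

lemma borel_measurable_spow [measurable]: "spow q \<in> borel_measurable borel"
  unfolding spow_def [abs_def] sgn_if by measurable

text \<open>Convexity of \<open>t powr q\<close>: the graph lies above its tangent at
  \<open>x\<close>. Young's inequality yields this without derivatives, so \<open>x = 0\<close>
  needs no separate case.\<close>

lemma powr_Young_tangent:
  fixes x y q :: real
  assumes "q > 1" "x \<ge> 0" "y \<ge> 0"
  shows "q * x powr (q - 1) * y \<le> (q - 1) * x powr q + y powr q"
proof -
  have "x powr (q - 1) * y \<le> (x powr (q - 1)) powr (q / (q - 1)) / (q / (q - 1)) + y powr q / q"
    using assms by (intro Youngs_inequality) (auto simp: field_simps)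
  also have "(x powr (q - 1)) powr (q / (q - 1)) = x powr q"
    using assms by (simp add: powr_powr)
  finally have "q * (x powr (q - 1) * y) \<le> q * (x powr q / (q / (q - 1)) + y powr q / q)"
    using assms by (intro mult_left_mono) auto
  also have "\<dots> = (q - 1) * x powr q + y powr q"
    using assms by (simp add: field_simps)
  finally show ?thesis by (simp add: mult_ac)
qed

lemma powr_pred_mult: "x \<ge> 0 \<Longrightarrow> x powr (q - 1) * x = x powr q" for x q :: real
  by (cases "x = 0") (auto simp: powr_mult_base [symmetric] powr_diff)

text \<open>Jensen's inequality, obtained by summing the tangent inequality at the mean
  \<open>z\<close>.\<close>

lemma sum_powr_le:
  fixes y :: "'i \<Rightarrow> real"
  assumes q: "q > 1" and S: "finite S" and y: "\<And>i. i \<in> S \<Longrightarrow> y i \<ge> 0"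
  shows "(\<Sum>i\<in>S. y i) powr q \<le> real (card S) powr (q - 1) * (\<Sum>i\<in>S. y i powr q)"
proof (cases "S = {}")
  case False
  define N where "N = real (card S)"
  have N: "N > 0" using False S by (auto simp: N_def card_gt_0_iff)
  define z where "z = (\<Sum>i\<in>S. y i) / N"
  have z: "z \<ge> 0" unfolding z_def using N y by (auto intro!: divide_nonneg_pos sum_nonneg)
  have Nz: "(\<Sum>i\<in>S. y i) = N * z" using N by (simp add: z_def)
  have "(\<Sum>i\<in>S. q * z powr (q - 1) * y i) \<le> (\<Sum>i\<in>S. (q - 1) * z powr q + y i powr q)"
    by (intro sum_mono powr_Young_tangent q z y)
  also have "(\<Sum>i\<in>S. q * z powr (q - 1) * y i) = q * z powr (q - 1) * (N * z)"
    by (simp add: sum_distrib_left [symmetric] Nz)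
  also have "\<dots> = q * N * z powr q"
    using powr_pred_mult [OF z, of q] by (simp add: mult_ac)
  also have "(\<Sum>i\<in>S. (q - 1) * z powr q + y i powr q) = N * (q - 1) * z powr q + (\<Sum>i\<in>S. y i powr q)"
    by (simp add: sum.distrib N_def)
  finally have "N * z powr q \<le> (\<Sum>i\<in>S. y i powr q)" by (simp add: algebra_simps)
  then have "N powr (q - 1) * (N * z powr q) \<le> N powr (q - 1) * (\<Sum>i\<in>S. y i powr q)"
    by (intro mult_left_mono) auto
  moreover have "N powr (q - 1) * (N * z powr q) = (N * z) powr q"
    using powr_pred_mult [of N q] N z by (simp add: powr_mult mult.assoc [symmetric])
  ultimately show ?thesis by (simp add: Nz N_def)
qed simp

lemma add_powr_le:
  fixes x y :: real
  assumes "q > 0" "x \<ge> 0" "y \<ge> 0"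
  shows "(x + y) powr q \<le> 2 powr q * (x powr q + y powr q)"
proof -
  have "(x + y) powr q \<le> (2 * max x y) powr q"
    using assms by (intro powr_mono2) auto
  also have "\<dots> = 2 powr q * max x y powr q" using assms by (simp add: powr_mult)
  also have "\<dots> \<le> 2 powr q * (x powr q + y powr q)"
    by (intro mult_left_mono) (auto simp: max_def)
  finally show ?thesis .
qed

lemma powr_diff_le:
  fixes a b :: real
  assumes "q > 1" "0 \<le> b" "b \<le> a"
  shows "a powr q - b powr q \<le> q * (a - b) * a powr (q - 1)"
proof -
  have "q * a powr (q - 1) * b \<le> (q - 1) * a powr q + b powr q"
    using assms by (intro powr_Young_tangent) auto
  moreover have "q * (a - b) * a powr (q - 1) = q * (a powr (q - 1) * a) - q * a powr (q - 1) * b"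
    by (simp add: algebra_simps)
  ultimately show ?thesis
    using powr_pred_mult [of a q] assms by (simp add: left_diff_distrib)
qed

text \<open>A mean value estimate for the signed power. The two endpoint values are added rather
  than maximised so that each can be passed to \<open>Holder_powr\<close> separately.\<close>

lemma spow_diff_le:
  fixes a b :: real
  assumes q: "q > 1"
  shows "\<bar>spow q a - spow q b\<bar> \<le> q * \<bar>a - b\<bar> * (\<bar>a\<bar> powr (q - 1) + \<bar>b\<bar> powr (q - 1))"
proof -
  have same: "\<bar>x powr q - y powr q\<bar> \<le> q * \<bar>x - y\<bar> * (\<bar>x\<bar> powr (q - 1) + \<bar>y\<bar> powr (q - 1))"
    if "x \<ge> 0" "y \<ge> 0" for x y
  proof -
    have le: "u powr q - v powr q \<le> q * (u - v) * (u powr (q - 1) + v powr (q - 1))"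
      if "0 \<le> v" "v \<le> u" for u v :: real
    proof -
      have "u powr q - v powr q \<le> q * (u - v) * u powr (q - 1)"
        by (rule powr_diff_le [OF q that])
      also have "\<dots> \<le> q * (u - v) * (u powr (q - 1) + v powr (q - 1))"
        using that q by (intro mult_left_mono) auto
      finally show ?thesis .
    qed
    show ?thesis
    proof (cases "y \<le> x")
      case True
      then show ?thesis using le [of y x] that powr_mono2 [of q y x] q by simp
    next
      case False
      then show ?thesis using le [of x y] that powr_mono2 [of q x y] q
        by (simp add: add.commute abs_minus_commute)
    qed
  qed
  have opp: "x powr q + y powr q \<le> q * (x + y) * (x powr (q - 1) + y powr (q - 1))"
    if "x \<ge> 0" "y \<ge> 0" for x y
  proof -
    have "x powr q + y powr q \<le> (x + y) * (x powr (q - 1) + y powr (q - 1))"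
      using powr_pred_mult [of x q] powr_pred_mult [of y q] that
      by (simp add: algebra_simps)
    also have "\<dots> \<le> q * ((x + y) * (x powr (q - 1) + y powr (q - 1)))"
      using mult_right_mono [of 1 q "(x + y) * (x powr (q - 1) + y powr (q - 1))"] q that by simp
    finally show ?thesis by (simp add: mult.assoc)
  qed
  consider "a \<ge> 0" "b \<ge> 0" | "a \<le> 0" "b \<le> 0" | "a \<ge> 0" "b \<le> 0" | "a \<le> 0" "b \<ge> 0" by linarith
  then show ?thesis
  proof cases
    case 1 then show ?thesis using same [of a b] q by (auto simp: spow_def sgn_if split: if_splits)
  next
    case 2 then show ?thesis using same [of "- a" "- b"] q
      by (auto simp: spow_def sgn_if abs_minus_commute split: if_splits)
  next
    case 3 then show ?thesis using opp [of a "- b"] q by (auto simp: spow_def sgn_if split: if_splits)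
  next
    case 4
    have "\<bar>- ((- a) powr q) - b powr q\<bar> = (- a) powr q + b powr q"
      using powr_ge_zero [of "- a" q] powr_ge_zero [of b q] by linarith
    then show ?thesis using 4 opp [of "- a" b] q
      by (auto simp: spow_def sgn_if split: if_splits)
  qed
qed

text \<open>Up to the factor \<open>p\<close>, \<open>spow (p - 1)\<close> is the derivative of the
  \<open>p\<close>-th absolute power. Convexity at the tangent point \<open>a + b\<close> gives a
  first-order bound with the derivative at the wrong point; \<open>spow_diff_le\<close> with
  exponent \<open>p - 1 > 1\<close> moves it to \<open>a\<close> at the price of the quadratic
  term.\<close>

lemma abs_powr_Taylor:
  fixes a b p :: real
  assumes p: "p > 2"
  shows "\<bar>a + b\<bar> powr p \<le> \<bar>a\<bar> powr p + p * (spow (p - 1) a * b)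
    + p * (p - 1) * (b\<^sup>2 * (\<bar>a + b\<bar> powr (p - 2) + \<bar>a\<bar> powr (p - 2)))"
proof -
  define y where "y = a + b"
  have yy: "spow (p - 1) y * y = \<bar>y\<bar> powr p"
    using powr_pred_mult [of "\<bar>y\<bar>" p] by (auto simp: spow_def sgn_if)
  have "spow (p - 1) y * a \<le> \<bar>y\<bar> powr (p - 1) * \<bar>a\<bar>"
    using abs_ge_self [of "spow (p - 1) y * a"] by (simp add: abs_mult abs_spow)
  then have "p * (spow (p - 1) y * a) \<le> p * (\<bar>y\<bar> powr (p - 1) * \<bar>a\<bar>)"
    using p by (intro mult_left_mono) auto
  also have "\<dots> \<le> (p - 1) * \<bar>y\<bar> powr p + \<bar>a\<bar> powr p"
    using powr_Young_tangent [of p "\<bar>y\<bar>" "\<bar>a\<bar>"] p by (simp add: mult.assoc)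
  finally have *: "p * (spow (p - 1) y * a) \<le> (p - 1) * \<bar>y\<bar> powr p + \<bar>a\<bar> powr p" .
  have 1: "\<bar>y\<bar> powr p \<le> \<bar>a\<bar> powr p + p * (spow (p - 1) y * b)"
  proof -
    have "p * (spow (p - 1) y * b) = p * (spow (p - 1) y * y) - p * (spow (p - 1) y * a)"
      by (simp add: y_def algebra_simps)
    then show ?thesis using * yy by (simp add: left_diff_distrib)
  qed
  have "(spow (p - 1) y - spow (p - 1) a) * b \<le> \<bar>spow (p - 1) y - spow (p - 1) a\<bar> * \<bar>b\<bar>"
    using abs_ge_self [of "(spow (p - 1) y - spow (p - 1) a) * b"] by (simp add: abs_mult)
  also have "\<dots> \<le> ((p - 1) * \<bar>b\<bar> * (\<bar>y\<bar> powr (p - 2) + \<bar>a\<bar> powr (p - 2))) * \<bar>b\<bar>"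
    using spow_diff_le [of "p - 1" y a] p by (intro mult_right_mono) (auto simp: y_def)
  also have "\<dots> = (p - 1) * (\<bar>b\<bar>\<^sup>2 * (\<bar>y\<bar> powr (p - 2) + \<bar>a\<bar> powr (p - 2)))"
    unfolding power2_eq_square by (simp only: mult_ac)
  also have "\<bar>b\<bar>\<^sup>2 = b\<^sup>2" by simp
  finally have "p * ((spow (p - 1) y - spow (p - 1) a) * b)
    \<le> p * ((p - 1) * (b\<^sup>2 * (\<bar>y\<bar> powr (p - 2) + \<bar>a\<bar> powr (p - 2))))"
    using p by (intro mult_left_mono) auto
  with 1 show ?thesis by (simp add: y_def algebra_simps)
qed

text \<open>Exponents \<open>p / 2\<close> and \<open>p / (p - 2)\<close>. Young's inequality is
  applied pointwise after normalising by the bounds, so integrability and the estimate come from the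
  same line.\<close>

lemma Holder_powr:
  fixes A T :: "'a \<Rightarrow> real"
  assumes p: "p > 2" and [measurable]: "A \<in> borel_measurable M" "T \<in> borel_measurable M"
    and A: "integrable M (\<lambda>x. \<bar>A x\<bar> powr (p / 2))" "(\<integral>x. \<bar>A x\<bar> powr (p / 2) \<partial>M) \<le> \<alpha> powr (p / 2)"
    and T: "integrable M (\<lambda>x. \<bar>T x\<bar> powr p)" "(\<integral>x. \<bar>T x\<bar> powr p \<partial>M) \<le> m"
    and \<alpha>: "\<alpha> \<ge> 0" and m: "m > 0"
  shows "integrable M (\<lambda>x. \<bar>A x\<bar> * \<bar>T x\<bar> powr (p - 2))" (is ?int)
    and "(\<integral>x. \<bar>A x\<bar> * \<bar>T x\<bar> powr (p - 2) \<partial>M) \<le> \<alpha> * m powr ((p - 2) / p)" (is ?le)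
proof -
  have bound: "\<bar>A x\<bar> * \<bar>T x\<bar> powr (p - 2)
      \<le> \<beta> * m powr ((p - 2) / p) * (2 / p * (\<bar>A x\<bar> powr (p / 2) / \<beta> powr (p / 2)) + (p - 2) / p * (\<bar>T x\<bar> powr p / m))"
    (is "_ \<le> ?c * ?R x") if \<beta>: "\<beta> > 0" for \<beta> x
  proof -
    have "(\<bar>A x\<bar> / \<beta>) * (\<bar>T x\<bar> powr (p - 2) / m powr ((p - 2) / p))
        \<le> (\<bar>A x\<bar> / \<beta>) powr (p / 2) / (p / 2)
          + (\<bar>T x\<bar> powr (p - 2) / m powr ((p - 2) / p)) powr (p / (p - 2)) / (p / (p - 2))"
      using p \<beta> m by (intro Youngs_inequality) (auto simp: field_simps)
    also have "(\<bar>T x\<bar> powr (p - 2) / m powr ((p - 2) / p)) powr (p / (p - 2)) = \<bar>T x\<bar> powr p / m"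
      using p m by (simp add: powr_divide powr_powr)
    also have "(\<bar>A x\<bar> / \<beta>) powr (p / 2) = \<bar>A x\<bar> powr (p / 2) / \<beta> powr (p / 2)"
      using \<beta> by (simp add: powr_divide)
    finally have "?c * ((\<bar>A x\<bar> / \<beta>) * (\<bar>T x\<bar> powr (p - 2) / m powr ((p - 2) / p))) \<le> ?c * ?R x"
      using \<beta> m by (intro mult_left_mono) (auto simp: field_simps)
    then show ?thesis using \<beta> m by simp
  qed
  have intR: "integrable M (\<lambda>x. \<beta> * m powr ((p - 2) / p) * (2 / p * (\<bar>A x\<bar> powr (p / 2) / \<beta> powr (p / 2)) + (p - 2) / p * (\<bar>T x\<bar> powr p / m)))" for \<beta>
    using A T by auto
  show int: ?int
    by (rule Bochner_Integration.integrable_bound [OF intR [of 1]])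
       (use bound [of 1] in \<open>auto intro!: AE_I2 order.trans [OF _ abs_ge_self]\<close>)
  have step: "(\<integral>x. \<bar>A x\<bar> * \<bar>T x\<bar> powr (p - 2) \<partial>M) \<le> \<beta> * m powr ((p - 2) / p)"
    if \<beta>: "\<beta> > 0" "\<beta> \<ge> \<alpha>" for \<beta>
  proof -
    have "(\<integral>x. \<bar>A x\<bar> * \<bar>T x\<bar> powr (p - 2) \<partial>M) \<le> (\<integral>x. \<beta> * m powr ((p - 2) / p) * (2 / p * (\<bar>A x\<bar> powr (p / 2) / \<beta> powr (p / 2)) + (p - 2) / p * (\<bar>T x\<bar> powr p / m)) \<partial>M)"
      by (intro integral_mono int intR bound \<beta>)
    also have "\<dots> = \<beta> * m powr ((p - 2) / p) * (2 / p * ((\<integral>x. \<bar>A x\<bar> powr (p / 2) \<partial>M) / \<beta> powr (p / 2))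
         + (p - 2) / p * ((\<integral>x. \<bar>T x\<bar> powr p \<partial>M) / m))"
      using A T by simp
    also have "\<dots> \<le> \<beta> * m powr ((p - 2) / p) * (2 / p * 1 + (p - 2) / p * 1)"
    proof -
      have "\<alpha> powr (p / 2) \<le> \<beta> powr (p / 2)" using \<alpha> \<beta> p by (intro powr_mono2) auto
      then show ?thesis
        using p \<beta> m A T by (intro mult_left_mono add_mono) auto
    qed
    also have "2 / p * 1 + (p - 2) / p * 1 = 1" using p by (simp add: field_simps)
    finally show ?thesis by simp
  qed
  show ?le
  proof (rule field_le_epsilon)
    fix e :: real assume e: "e > 0"
    \<comment> \<open>\<open>\<alpha>\<close> may be 0, which rules out normalising by
      \<open>\<alpha>\<close> itself. The slightly larger \<open>\<beta>\<close> is chosen so that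
      the excess in the final bound is exactly \<open>e\<close>.\<close>
    define \<beta> where "\<beta> = \<alpha> + e / m powr ((p - 2) / p)"
    have "\<beta> * m powr ((p - 2) / p) = \<alpha> * m powr ((p - 2) / p) + e"
      using m by (simp add: \<beta>_def field_simps)
    moreover have "\<beta> > 0" "\<beta> \<ge> \<alpha>" using e \<alpha> m by (auto simp: \<beta>_def add_nonneg_pos)
    ultimately show "(\<integral>x. \<bar>A x\<bar> * \<bar>T x\<bar> powr (p - 2) \<partial>M) \<le> \<alpha> * m powr ((p - 2) / p) + e"
      using step [of \<beta>] by simp
  qed
qed

section \<open>A moment inequality for stationary random fields\<close>

lemma imax_minus: "imax (- k) = imax k"
  by (simp add: imax_def)

lemma imax_ge: "\<bar>k $ l\<bar> \<le> imax k"
  unfolding imax_def by (intro Max_ge) auto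

lemma lex_less_trans:
  assumes "lex_less i j" "lex_less j k"
  shows "lex_less i k"
proof -
  obtain q where q: "i $ q < j $ q" "\<And>r. r < q \<Longrightarrow> i $ r = j $ r"
    using assms(1) by (auto simp: lex_less_def)
  obtain s where s: "j $ s < k $ s" "\<And>r. r < s \<Longrightarrow> j $ r = k $ r"
    using assms(2) by (auto simp: lex_less_def)
  have "i $ min q s < k $ min q s"
    using q s by (cases q s rule: linorder_cases) (auto simp: min_def)
  moreover have "i $ r = k $ r" if "r < min q s" for r using that q s by auto
  ultimately show ?thesis unfolding lex_less_def by blast
qed

lemma lex_less_total:
  assumes "i \<noteq> j"
  shows "lex_less i j \<or> lex_less j i"
proof -
  let ?A = "{q. i $ q \<noteq> j $ q}"
  have ne: "?A \<noteq> {}" using assms by (auto simp: vec_eq_iff)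
  define q where "q = Min ?A"
  have q: "i $ q \<noteq> j $ q" using Min_in [OF _ ne] by (auto simp: q_def)
  have "i $ r = j $ r" if "r < q" for r
    using that Min_le [of ?A r] unfolding q_def by fastforce
  then show ?thesis using q unfolding lex_less_def by (metis linorder_neqE)
qed

text \<open>Removing this site leaves a set lying entirely in its past, so a sum can be built up one
  site at a time with conditioning on lexicographic predecessors only.\<close>

lemma finite_has_lex_max:
  assumes "finite S" "S \<noteq> {}"
  obtains i where "i \<in> S" "\<And>j. j \<in> S - {i} \<Longrightarrow> lex_less j i"
proof -
  have "\<exists>i\<in>S. \<forall>j\<in>S - {i}. lex_less j i"
    using assms
  proof (induction rule: finite_ne_induct)
    case (insert x F)
    then obtain i where i: "i \<in> F" "\<And>j. j \<in> F - {i} \<Longrightarrow> lex_less j i" by auto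
    with insert have "x \<noteq> i" by auto
    then consider "lex_less x i" | "lex_less i x" using lex_less_total by blast
    then show ?case
    proof cases
      case 1
      then show ?thesis using i by (intro bexI [of _ i]) auto
    next
      case 2
      then show ?thesis using i by (intro bexI [of _ x]) (auto intro: lex_less_trans)
    qed
  qed auto
  then show ?thesis using that by blast
qed

lemma lex_less_imp_Vset_1: "lex_less j i \<Longrightarrow> j \<in> Vset i 1"
proof -
  assume l: "lex_less j i"
  then obtain q where "j $ q < i $ q" by (auto simp: lex_less_def)
  then have "1 \<le> \<bar>(i - j) $ q\<bar>" by simp
  also have "\<dots> \<le> imax (i - j)" by (rule imax_ge)
  finally show ?thesis using l by (simp add: Vset_def)
qed

lemma lex_less_diff: "lex_less (j - i) 0 \<longleftrightarrow> lex_less j i"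
  by (simp add: lex_less_def)

lemma Lpnorm_finite:
  assumes q: "q > 0" and [measurable]: "X \<in> borel_measurable M" and fin: "Lpnorm M q X < \<infinity>"
  shows "integrable M (\<lambda>\<omega>. \<bar>X \<omega>\<bar> powr q)"
    and "(\<integral>\<omega>. \<bar>X \<omega>\<bar> powr q \<partial>M) = enn2real (Lpnorm M q X) powr q"
proof -
  let ?I = "\<integral>\<^sup>+ \<omega>. ennreal (\<bar>X \<omega>\<bar> powr q) \<partial>M"
  have I: "?I < \<infinity>" using fin by (auto simp: Lpnorm_def Let_def less_top split: if_splits)
  then show int: "integrable M (\<lambda>\<omega>. \<bar>X \<omega>\<bar> powr q)"
    by (intro integrableI_bounded) auto
  have "(\<integral>\<omega>. \<bar>X \<omega>\<bar> powr q \<partial>M) = enn2real ?I"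
    by (intro integral_eq_nn_integral) auto
  also have "\<dots> = enn2real (Lpnorm M q X) powr q"
    using I q by (auto simp: Lpnorm_def Let_def powr_powr less_top)
  finally show "(\<integral>\<omega>. \<bar>X \<omega>\<bar> powr q \<partial>M) = enn2real (Lpnorm M q X) powr q" .
qed

locale stationary_C3_field = prob_space M for M :: "'a measure" +
  fixes eps :: "(int, 'd::{finite,linorder}) vec \<Rightarrow> 'a \<Rightarrow> real" and p :: real
  assumes meas [measurable]: "\<And>j. eps j \<in> borel_measurable M"
    and stationary: "\<And>k I. finite I \<Longrightarrow>
        distr M (Pi\<^sub>M I (\<lambda>_. borel)) (\<lambda>\<omega>. restrict (\<lambda>i. eps (i + k) \<omega>) I)
      = distr M (Pi\<^sub>M I (\<lambda>_. borel)) (\<lambda>\<omega>. restrict (\<lambda>i. eps i \<omega>) I)"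
    and p_gt: "p > 2"
    and Lp: "integrable M (\<lambda>\<omega>. \<bar>eps 0 \<omega>\<bar> powr p)"
    and C3: "(\<Sum>\<^sub>\<infinity> k\<in>Vset 0 1.
               Lpnorm M (p / 2) (\<lambda>\<omega>. eps k \<omega> * real_cond_exp M (Fsig M eps (Vset 0 (imax k))) (eps 0) \<omega>))
             < \<infinity>"
begin

section \<open>Translation of sites and integrability of weighted sums\<close>

lemma shift_invariant:
  fixes F :: "((int, 'd) vec \<Rightarrow> real) \<Rightarrow> real"
  assumes I: "finite I" and [measurable]: "F \<in> borel_measurable (Pi\<^sub>M I (\<lambda>_. borel))"
  shows "(\<integral>\<omega>. F (restrict (\<lambda>i. eps (i + k) \<omega>) I) \<partial>M) = (\<integral>\<omega>. F (restrict (\<lambda>i. eps i \<omega>) I) \<partial>M)"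
    and "integrable M (\<lambda>\<omega>. F (restrict (\<lambda>i. eps (i + k) \<omega>) I)) \<longleftrightarrow>
      integrable M (\<lambda>\<omega>. F (restrict (\<lambda>i. eps i \<omega>) I))"
proof -
  have [measurable]: "(\<lambda>\<omega>. restrict (\<lambda>i. eps (i + k) \<omega>) I) \<in> M \<rightarrow>\<^sub>M Pi\<^sub>M I (\<lambda>_. borel)" for k
    by (intro measurable_restrict) simp
  have [measurable]: "(\<lambda>\<omega>. restrict (\<lambda>i. eps i \<omega>) I) \<in> M \<rightarrow>\<^sub>M Pi\<^sub>M I (\<lambda>_. borel)"
    by (intro measurable_restrict) simp
  show "(\<integral>\<omega>. F (restrict (\<lambda>i. eps (i + k) \<omega>) I) \<partial>M) = (\<integral>\<omega>. F (restrict (\<lambda>i. eps i \<omega>) I) \<partial>M)"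
    using arg_cong [OF stationary [OF I, of k], of "\<lambda>D. integral\<^sup>L D F"]
    by (simp add: integral_distr)
  show "integrable M (\<lambda>\<omega>. F (restrict (\<lambda>i. eps (i + k) \<omega>) I)) \<longleftrightarrow>
      integrable M (\<lambda>\<omega>. F (restrict (\<lambda>i. eps i \<omega>) I))"
    using arg_cong [OF stationary [OF I, of k], of "\<lambda>D. integrable D F"]
    by (simp add: integrable_distr_eq)
qed

lemma shift_one:
  fixes f :: "real \<Rightarrow> real"
  assumes [measurable]: "f \<in> borel_measurable borel"
  shows "(\<integral>\<omega>. f (eps i \<omega>) \<partial>M) = (\<integral>\<omega>. f (eps 0 \<omega>) \<partial>M)"
    and "integrable M (\<lambda>\<omega>. f (eps i \<omega>)) \<longleftrightarrow> integrable M (\<lambda>\<omega>. f (eps 0 \<omega>))"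
  using shift_invariant [of "{0}" "\<lambda>y. f (y 0)" i] by simp_all

lemma eps_Lp: "integrable M (\<lambda>\<omega>. \<bar>eps i \<omega>\<bar> powr p)"
  using shift_one(2) [of "\<lambda>x. \<bar>x\<bar> powr p" i] Lp by simp

text \<open>The shift \<open>s\<close> moves the sites while each weight stays attached to its index
  \<open>j\<close>: the weights are not translation invariant, so stationarity is applied to the
  field with the weights held fixed.\<close>

definition wsum :: "((int, 'd) vec \<Rightarrow> real) \<Rightarrow> (int, 'd) vec set \<Rightarrow> (int, 'd) vec \<Rightarrow> 'a \<Rightarrow> real" where
  "wsum w \<Delta> s \<omega> = (\<Sum>j\<in>\<Delta>. w j * eps (j - s) \<omega>)"

lemma wsum_measurable [measurable]: "wsum w \<Delta> s \<in> borel_measurable M"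
  unfolding wsum_def by measurable

lemma wsum_Lp:
  assumes "finite \<Delta>"
  shows "integrable M (\<lambda>\<omega>. \<bar>wsum w \<Delta> s \<omega>\<bar> powr p)"
proof (rule Bochner_Integration.integrable_bound)
  show "integrable M (\<lambda>\<omega>. real (card \<Delta>) powr (p - 1) * (\<Sum>j\<in>\<Delta>. \<bar>w j\<bar> powr p * \<bar>eps (j - s) \<omega>\<bar> powr p))"
    using eps_Lp by auto
  show "AE \<omega> in M. norm (\<bar>wsum w \<Delta> s \<omega>\<bar> powr p)
     \<le> norm (real (card \<Delta>) powr (p - 1) * (\<Sum>j\<in>\<Delta>. \<bar>w j\<bar> powr p * \<bar>eps (j - s) \<omega>\<bar> powr p))"
  proof (intro AE_I2)
    fix \<omega>
    have "\<bar>wsum w \<Delta> s \<omega>\<bar> powr p \<le> (\<Sum>j\<in>\<Delta>. \<bar>w j * eps (j - s) \<omega>\<bar>) powr p"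
      unfolding wsum_def using p_gt by (intro powr_mono2 sum_abs) auto
    also have "\<dots> \<le> real (card \<Delta>) powr (p - 1) * (\<Sum>j\<in>\<Delta>. \<bar>w j * eps (j - s) \<omega>\<bar> powr p)"
      using p_gt assms by (intro sum_powr_le) auto
    also have "\<dots> = real (card \<Delta>) powr (p - 1) * (\<Sum>j\<in>\<Delta>. \<bar>w j\<bar> powr p * \<bar>eps (j - s) \<omega>\<bar> powr p)"
      by (simp add: abs_mult powr_mult)
    finally show "norm (\<bar>wsum w \<Delta> s \<omega>\<bar> powr p)
     \<le> norm (real (card \<Delta>) powr (p - 1) * (\<Sum>j\<in>\<Delta>. \<bar>w j\<bar> powr p * \<bar>eps (j - s) \<omega>\<bar> powr p))"
      by simp
  qed
qed measurable

text \<open>Two partial sums and the site multiplying them have to be translated jointly.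
  \<open>I\<close> collects the translated indices, among them 0 as the image of
  \<open>i\<close>.\<close>

lemma shift_wsum:
  fixes f :: "real \<Rightarrow> real \<Rightarrow> real \<Rightarrow> real"
  assumes fin: "finite \<Delta>" "finite \<Delta>'"
    and f: "(\<lambda>(x, y, z). f x y z) \<in> borel_measurable (borel \<Otimes>\<^sub>M borel \<Otimes>\<^sub>M borel)"
  shows "(\<integral>\<omega>. f (wsum w \<Delta> 0 \<omega>) (wsum w \<Delta>' 0 \<omega>) (eps i \<omega>) \<partial>M)
       = (\<integral>\<omega>. f (wsum w \<Delta> i \<omega>) (wsum w \<Delta>' i \<omega>) (eps 0 \<omega>) \<partial>M)"
proof -
  define I where "I = (\<lambda>j. j - i) ` (insert i (\<Delta> \<union> \<Delta>'))"
  have mem: "j - i \<in> I" if "j \<in> \<Delta> \<or> j \<in> \<Delta>'" for j using that by (auto simp: I_def)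
  have mem0: "0 \<in> I" by (force simp: I_def)
  define F where "F y = f (\<Sum>j\<in>\<Delta>. w j * y (j - i)) (\<Sum>j\<in>\<Delta>'. w j * y (j - i)) (y 0)" for y
  have finI: "finite I" using fin by (simp add: I_def)
  have [measurable]: "F \<in> borel_measurable (Pi\<^sub>M I (\<lambda>_. borel))"
  proof -
    have c: "(\<lambda>y. y j) \<in> borel_measurable (Pi\<^sub>M I (\<lambda>_. borel :: real measure))" if "j \<in> I" for j
      using that by (rule measurable_component_singleton)
    have "(\<lambda>y. (\<Sum>j\<in>\<Delta>. w j * y (j - i), \<Sum>j\<in>\<Delta>'. w j * y (j - i), y 0))
       \<in> Pi\<^sub>M I (\<lambda>_. borel) \<rightarrow>\<^sub>M borel \<Otimes>\<^sub>M borel \<Otimes>\<^sub>M borel"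
      by (intro measurable_Pair borel_measurable_sum borel_measurable_times c mem mem0 borel_measurable_const) auto
    from measurable_compose [OF this f] show ?thesis by (simp add: F_def [abs_def])
  qed
  from shift_invariant(1) [OF finI this, of i] show ?thesis
    by (simp add: F_def wsum_def mem mem0 cong: sum.cong)
qed

lemma spow_times_integrable:
  assumes [measurable]: "X \<in> borel_measurable M" "Y \<in> borel_measurable M"
    and X: "integrable M (\<lambda>\<omega>. \<bar>X \<omega>\<bar> powr p)" and Y: "integrable M (\<lambda>\<omega>. \<bar>Y \<omega>\<bar> powr p)"
  shows "integrable M (\<lambda>\<omega>. spow (p - 1) (X \<omega>) * Y \<omega>)"
proof (rule Bochner_Integration.integrable_bound)
  show "integrable M (\<lambda>\<omega>. (p - 1) * \<bar>X \<omega>\<bar> powr p + \<bar>Y \<omega>\<bar> powr p)"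
    using X Y by auto
  show "AE \<omega> in M. norm (spow (p - 1) (X \<omega>) * Y \<omega>) \<le> norm ((p - 1) * \<bar>X \<omega>\<bar> powr p + \<bar>Y \<omega>\<bar> powr p)"
  proof (intro AE_I2)
    fix \<omega>
    have "norm (spow (p - 1) (X \<omega>) * Y \<omega>) \<le> p * \<bar>X \<omega>\<bar> powr (p - 1) * \<bar>Y \<omega>\<bar>"
      using mult_right_mono [of 1 p "\<bar>X \<omega>\<bar> powr (p - 1) * \<bar>Y \<omega>\<bar>"] p_gt by (simp add: abs_mult abs_spow mult.assoc)
    also have "\<dots> \<le> (p - 1) * \<bar>X \<omega>\<bar> powr p + \<bar>Y \<omega>\<bar> powr p"
      using p_gt by (intro powr_Young_tangent) auto
    finally show "norm (spow (p - 1) (X \<omega>) * Y \<omega>) \<le> norm ((p - 1) * \<bar>X \<omega>\<bar> powr p + \<bar>Y \<omega>\<bar> powr p)"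
      by simp
  qed
qed measurable

section \<open>Summands of (C3) and the sigma-algebras generated by the field\<close>

definition dep :: "(int, 'd) vec \<Rightarrow> real" where
  "dep k = enn2real (Lpnorm M (p / 2)
     (\<lambda>\<omega>. eps k \<omega> * real_cond_exp M (Fsig M eps (Vset 0 (imax k))) (eps 0) \<omega>))"

definition dep_total :: real where
  "dep_total = enn2real (\<Sum>\<^sub>\<infinity> k\<in>Vset 0 1. Lpnorm M (p / 2)
     (\<lambda>\<omega>. eps k \<omega> * real_cond_exp M (Fsig M eps (Vset 0 (imax k))) (eps 0) \<omega>))"

lemma sum_Lpnorm_le:
  assumes "finite F" "F \<subseteq> Vset 0 1"
  shows "(\<Sum>k\<in>F. Lpnorm M (p / 2) (\<lambda>\<omega>. eps k \<omega> * real_cond_exp M (Fsig M eps (Vset 0 (imax k))) (eps 0) \<omega>))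
    \<le> (\<Sum>\<^sub>\<infinity> k\<in>Vset 0 1. Lpnorm M (p / 2)
     (\<lambda>\<omega>. eps k \<omega> * real_cond_exp M (Fsig M eps (Vset 0 (imax k))) (eps 0) \<omega>))"
  using assms by (subst nonneg_infsum_complete) (auto intro!: SUP_upper)

text \<open>A finite total in (C3) makes every summand finite, so on \<open>Vset 0 1\<close> the
  \<open>enn2real\<close> in \<open>dep\<close> never turns an infinite value into 0.\<close>

lemma Lpnorm_dep:
  assumes "k \<in> Vset 0 1"
  shows "Lpnorm M (p / 2) (\<lambda>\<omega>. eps k \<omega> * real_cond_exp M (Fsig M eps (Vset 0 (imax k))) (eps 0) \<omega>) = ennreal (dep k)"
proof -
  have "Lpnorm M (p / 2) (\<lambda>\<omega>. eps k \<omega> * real_cond_exp M (Fsig M eps (Vset 0 (imax k))) (eps 0) \<omega>) < \<infinity>"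
    using sum_Lpnorm_le [of "{k}"] assms C3 by (simp add: order.strict_trans1)
  then show ?thesis by (simp add: dep_def)
qed

lemma dep_nonneg: "dep k \<ge> 0"
  by (simp add: dep_def)

lemma sum_dep_le:
  assumes "finite F" "F \<subseteq> Vset 0 1"
  shows "(\<Sum>k\<in>F. dep k) \<le> dep_total"
proof -
  have "ennreal (\<Sum>k\<in>F. dep k) = (\<Sum>k\<in>F. ennreal (dep k))"
    by (simp add: dep_nonneg)
  also have "\<dots> = (\<Sum>k\<in>F. Lpnorm M (p / 2) (\<lambda>\<omega>. eps k \<omega> * real_cond_exp M (Fsig M eps (Vset 0 (imax k))) (eps 0) \<omega>))"
    using assms by (intro sum.cong refl Lpnorm_dep [symmetric]) auto
  also have "\<dots> \<le> ennreal dep_total"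
    using sum_Lpnorm_le [OF assms] C3 by (simp add: dep_total_def)
  finally show ?thesis by (simp add: dep_total_def)
qed

lemma dep_total_nonneg: "dep_total \<ge> 0"
  by (simp add: dep_total_def)

lemma sets_Fsig: "sets (Fsig M eps \<Gamma>) = sigma_sets (space M) (\<Union>j\<in>\<Gamma>. {eps j -` B \<inter> space M | B. B \<in> sets borel})"
  unfolding Fsig_def by (rule sets_measure_of) auto

lemma space_Fsig: "space (Fsig M eps \<Gamma>) = space M"
  unfolding Fsig_def by (rule space_measure_of) auto

lemma finite_measure_subalgebra_Fsig: "finite_measure_subalgebra M (Fsig M eps \<Gamma>)"
proof
  have "sigma_sets (space M) (\<Union>j\<in>\<Gamma>. {eps j -` B \<inter> space M | B. B \<in> sets borel}) \<subseteq> sets M"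
    by (intro sets.sigma_sets_subset) auto
  then show "subalgebra M (Fsig M eps \<Gamma>)"
    by (simp add: subalgebra_def sets_Fsig space_Fsig)
qed

lemma eps_measurable_Fsig:
  assumes "j \<in> \<Gamma>"
  shows "eps j \<in> borel_measurable (Fsig M eps \<Gamma>)"
proof (rule measurableI)
  fix B :: "real set" assume "B \<in> sets borel"
  then show "eps j -` B \<inter> space (Fsig M eps \<Gamma>) \<in> sets (Fsig M eps \<Gamma>)"
    unfolding sets_Fsig space_Fsig using assms by (intro sigma_sets.Basic) auto
qed simp

text \<open>The nearest point to \<open>i\<close> is removed first, so the difference of the two powers is a function of
  sites at distance at least \<open>imax (i - k)\<close> from \<open>i\<close>. Translating the expectation by \<open>- i\<close> before
  conditioning uses only finite-dimensional stationarity, and no conditional expectation has to be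
  transported from one site to another.\<close>

lemma conditioning_step:
  assumes fin: "finite \<Delta>" and sub: "\<Delta> \<subseteq> Vset i 1" and k: "k \<in> \<Delta>"
    and near: "\<And>j. j \<in> \<Delta> \<Longrightarrow> imax (i - k) \<le> imax (i - j)"
    and w: "\<And>j. \<bar>w j\<bar> \<le> 1" and m: "m > 0"
    and m1: "(\<integral>\<omega>. \<bar>wsum w \<Delta> 0 \<omega>\<bar> powr p \<partial>M) \<le> m"
    and m2: "(\<integral>\<omega>. \<bar>wsum w (\<Delta> - {k}) 0 \<omega>\<bar> powr p \<partial>M) \<le> m"
  shows "(\<integral>\<omega>. (spow (p - 1) (wsum w \<Delta> 0 \<omega>) - spow (p - 1) (wsum w (\<Delta> - {k}) 0 \<omega>)) * (w i * eps i \<omega>) \<partial>M)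
    \<le> 2 * (p - 1) * dep (k - i) * m powr ((p - 2) / p)"
proof -
  let ?F = "Fsig M eps (Vset 0 (imax (k - i)))"
  interpret F: finite_measure_subalgebra M ?F by (rule finite_measure_subalgebra_Fsig)
  let ?E = "real_cond_exp M ?F (eps 0)"
  define T1 where "T1 = wsum w \<Delta> i"
  define T2 where "T2 = wsum w (\<Delta> - {k}) i"
  define G where "G = (\<lambda>\<omega>. spow (p - 1) (T1 \<omega>) - spow (p - 1) (T2 \<omega>))"
  define A where "A = (\<lambda>\<omega>. eps (k - i) \<omega> * ?E \<omega>)"
  have imax_ki: "imax (k - i) = imax (i - k)" using imax_minus [of "i - k"] by simp
  have kV: "k - i \<in> Vset 0 1"
    using k sub by (auto simp: Vset_def lex_less_diff)
  have [measurable]: "T1 \<in> borel_measurable M" "T2 \<in> borel_measurable M" "A \<in> borel_measurable M"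
    unfolding T1_def T2_def A_def by measurable
  have T12: "T1 \<omega> - T2 \<omega> = w k * eps (k - i) \<omega>" for \<omega>
    using fin k by (simp add: T1_def T2_def wsum_def sum.remove)
  have inV: "j - i \<in> Vset 0 (imax (k - i))" if "j \<in> \<Delta>" for j
    using that sub near [OF that] by (auto simp: Vset_def lex_less_diff imax_ki)
  have GF [measurable]: "G \<in> borel_measurable ?F"
    unfolding G_def T1_def T2_def wsum_def
    by (intro borel_measurable_diff measurable_compose [OF _ borel_measurable_spow] borel_measurable_sum
        borel_measurable_times borel_measurable_const eps_measurable_Fsig inV) auto
  have Tint: "integrable M (\<lambda>\<omega>. \<bar>T1 \<omega>\<bar> powr p)" "integrable M (\<lambda>\<omega>. \<bar>T2 \<omega>\<bar> powr p)"
    unfolding T1_def T2_def using fin by (auto intro: wsum_Lp)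
  have T1m: "(\<integral>\<omega>. \<bar>T1 \<omega>\<bar> powr p \<partial>M) \<le> m"
    using m1 shift_wsum [OF fin fin, of "\<lambda>x y z. \<bar>x\<bar> powr p" w i] by (simp add: T1_def split_beta)
  have fin': "finite (\<Delta> - {k})" using fin by simp
  have T2m: "(\<integral>\<omega>. \<bar>T2 \<omega>\<bar> powr p \<partial>M) \<le> m"
    using m2 shift_wsum [OF fin' fin', of "\<lambda>x y z. \<bar>x\<bar> powr p" w i] by (simp add: T2_def split_beta)
  have Geps: "integrable M (\<lambda>\<omega>. G \<omega> * eps 0 \<omega>)"
    unfolding G_def left_diff_distrib
    by (intro Bochner_Integration.integrable_diff spow_times_integrable Tint eps_Lp) auto
  note cond = F.real_cond_exp_intg [OF Geps GF meas]
  have A_fin: "Lpnorm M (p / 2) A = ennreal (dep (k - i))"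
    unfolding A_def by (rule Lpnorm_dep [OF kV])
  have Ap: "integrable M (\<lambda>\<omega>. \<bar>A \<omega>\<bar> powr (p / 2))"
    "(\<integral>\<omega>. \<bar>A \<omega>\<bar> powr (p / 2) \<partial>M) \<le> dep (k - i) powr (p / 2)"
    using Lpnorm_finite [of "p / 2" A M] p_gt A_fin by (auto simp: dep_nonneg)
  note H1 = Holder_powr [OF p_gt _ _ Ap Tint(1) T1m dep_nonneg m]
  note H2 = Holder_powr [OF p_gt _ _ Ap Tint(2) T2m dep_nonneg m]
  \<comment> \<open>\<open>T1\<close> and \<open>T2\<close> differ by one site, so the mean value
    bound on \<open>G\<close> releases the factor \<open>eps (k - i)\<close>. Together with the
    conditional expectation it forms \<open>A\<close>, whose norm of order \<open>p / 2\<close> is a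
    summand of (C3); powers of order \<open>p - 2\<close> of the sums remain for Hoelder.\<close>
  have GE: "w i * (G \<omega> * ?E \<omega>) \<le> (p - 1) * (\<bar>A \<omega>\<bar> * \<bar>T1 \<omega>\<bar> powr (p - 2) + \<bar>A \<omega>\<bar> * \<bar>T2 \<omega>\<bar> powr (p - 2))" for \<omega>
  proof -
    have "w i * (G \<omega> * ?E \<omega>) \<le> \<bar>w i\<bar> * (\<bar>G \<omega>\<bar> * \<bar>?E \<omega>\<bar>)"
      using abs_ge_self [of "w i * (G \<omega> * ?E \<omega>)"] by (simp add: abs_mult)
    also have "\<dots> \<le> 1 * (\<bar>G \<omega>\<bar> * \<bar>?E \<omega>\<bar>)"
      by (intro mult_right_mono w) auto
    also have "\<bar>G \<omega>\<bar> \<le> (p - 1) * \<bar>T1 \<omega> - T2 \<omega>\<bar> * (\<bar>T1 \<omega>\<bar> powr (p - 2) + \<bar>T2 \<omega>\<bar> powr (p - 2))"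
      using spow_diff_le [of "p - 1" "T1 \<omega>" "T2 \<omega>"] p_gt by (simp add: G_def)
    also have "\<bar>T1 \<omega> - T2 \<omega>\<bar> \<le> 1 * \<bar>eps (k - i) \<omega>\<bar>"
      unfolding T12 abs_mult by (intro mult_right_mono w) auto
    finally have "w i * (G \<omega> * ?E \<omega>)
      \<le> 1 * ((p - 1) * (1 * \<bar>eps (k - i) \<omega>\<bar>) * (\<bar>T1 \<omega>\<bar> powr (p - 2) + \<bar>T2 \<omega>\<bar> powr (p - 2)) * \<bar>?E \<omega>\<bar>)"
      using p_gt by (simp add: mult_right_mono mult_left_mono)
    also have "\<dots> = (p - 1) * (\<bar>A \<omega>\<bar> * \<bar>T1 \<omega>\<bar> powr (p - 2) + \<bar>A \<omega>\<bar> * \<bar>T2 \<omega>\<bar> powr (p - 2))"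
      by (simp add: A_def abs_mult algebra_simps)
    finally show ?thesis .
  qed
  have "(\<integral>\<omega>. (spow (p - 1) (wsum w \<Delta> 0 \<omega>) - spow (p - 1) (wsum w (\<Delta> - {k}) 0 \<omega>)) * (w i * eps i \<omega>) \<partial>M)
    = (\<integral>\<omega>. G \<omega> * (w i * eps 0 \<omega>) \<partial>M)"
    using shift_wsum [OF fin fin', of "\<lambda>x y z. (spow (p - 1) x - spow (p - 1) y) * (w i * z)" w i]
    by (simp add: G_def T1_def T2_def split_beta)
  also have "\<dots> = (\<integral>\<omega>. w i * (G \<omega> * eps 0 \<omega>) \<partial>M)" by (simp add: mult_ac)
  also have "\<dots> = (\<integral>\<omega>. w i * (G \<omega> * ?E \<omega>) \<partial>M)" using cond(2) by simp
  also have "\<dots> \<le> (\<integral>\<omega>. (p - 1) * (\<bar>A \<omega>\<bar> * \<bar>T1 \<omega>\<bar> powr (p - 2) + \<bar>A \<omega>\<bar> * \<bar>T2 \<omega>\<bar> powr (p - 2)) \<partial>M)"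
    using cond(1) H1(1) H2(1) by (intro integral_mono GE) auto
  also have "\<dots> = (p - 1) * ((\<integral>\<omega>. \<bar>A \<omega>\<bar> * \<bar>T1 \<omega>\<bar> powr (p - 2) \<partial>M) + (\<integral>\<omega>. \<bar>A \<omega>\<bar> * \<bar>T2 \<omega>\<bar> powr (p - 2) \<partial>M))"
    using H1(1) H2(1) by simp
  also have "\<dots> \<le> (p - 1) * (dep (k - i) * m powr ((p - 2) / p) + dep (k - i) * m powr ((p - 2) / p))"
    using p_gt H1(2) H2(2) by (intro mult_left_mono add_mono) auto
  finally show ?thesis by (simp add: algebra_simps)
qed

text \<open>Telescoping by repeated deletion of the site nearest to \<open>i\<close>: each deletion
  costs one summand of (C3), and the empty sum contributes nothing because \<open>spow\<close>
  vanishes at 0. \<open>bound\<close> ranges over all subsets to cover the intermediate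
  sums.\<close>

lemma spow_wsum_times_eps_le:
  assumes fin: "finite \<Delta>" and sub: "\<Delta> \<subseteq> Vset i 1"
    and w: "\<And>j. \<bar>w j\<bar> \<le> 1" and m: "m > 0"
    and bound: "\<And>\<Delta>'. \<Delta>' \<subseteq> \<Delta> \<Longrightarrow> (\<integral>\<omega>. \<bar>wsum w \<Delta>' 0 \<omega>\<bar> powr p \<partial>M) \<le> m"
  shows "(\<integral>\<omega>. spow (p - 1) (wsum w \<Delta> 0 \<omega>) * (w i * eps i \<omega>) \<partial>M)
    \<le> 2 * (p - 1) * (\<Sum>k\<in>\<Delta>. dep (k - i)) * m powr ((p - 2) / p)"
  using fin sub bound
proof (induction "card \<Delta>" arbitrary: \<Delta>)
  case 0
  then show ?case by (simp add: wsum_def spow_def)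
next
  case (Suc n)
  then have ne: "\<Delta> \<noteq> {}" by auto
  obtain k where k: "k \<in> \<Delta>" "\<And>j. j \<in> \<Delta> \<Longrightarrow> imax (i - k) \<le> imax (i - j)"
    using ex_is_arg_min_if_finite [OF Suc.prems(1) ne, of "\<lambda>k. imax (i - k)"]
    by (auto simp: is_arg_min_linorder)
  have IH: "(\<integral>\<omega>. spow (p - 1) (wsum w (\<Delta> - {k}) 0 \<omega>) * (w i * eps i \<omega>) \<partial>M)
    \<le> 2 * (p - 1) * (\<Sum>k\<in>\<Delta> - {k}. dep (k - i)) * m powr ((p - 2) / p)"
    using Suc.hyps(2) Suc.prems k by (intro Suc.hyps(1)) (auto simp: subset_iff)
  have int: "integrable M (\<lambda>\<omega>. spow (p - 1) (wsum w \<Delta>' 0 \<omega>) * (w i * eps i \<omega>))" if "finite \<Delta>'" for \<Delta>'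
    using integrable_mult_right [OF spow_times_integrable [OF wsum_measurable meas wsum_Lp eps_Lp, of \<Delta>' w 0 i], of "w i"] that
    by (simp only: mult.left_commute)
  have "(\<integral>\<omega>. spow (p - 1) (wsum w \<Delta> 0 \<omega>) * (w i * eps i \<omega>) \<partial>M)
    = (\<integral>\<omega>. spow (p - 1) (wsum w (\<Delta> - {k}) 0 \<omega>) * (w i * eps i \<omega>) \<partial>M)
      + (\<integral>\<omega>. (spow (p - 1) (wsum w \<Delta> 0 \<omega>) - spow (p - 1) (wsum w (\<Delta> - {k}) 0 \<omega>)) * (w i * eps i \<omega>) \<partial>M)"
    using int [OF Suc.prems(1)] int [of "\<Delta> - {k}"] Suc.prems(1) by (simp add: left_diff_distrib)
  also have "\<dots> \<le> 2 * (p - 1) * (\<Sum>k\<in>\<Delta> - {k}. dep (k - i)) * m powr ((p - 2) / p)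
      + 2 * (p - 1) * dep (k - i) * m powr ((p - 2) / p)"
    using Suc.prems k w m by (intro add_mono IH conditioning_step) auto
  also have "\<dots> = 2 * (p - 1) * (\<Sum>k\<in>\<Delta>. dep (k - i)) * m powr ((p - 2) / p)"
    using k Suc.prems(1) by (simp add: sum.remove algebra_simps)
  finally show ?case .
qed

definition eps_moment :: real where
  "eps_moment = (\<integral>\<omega>. \<bar>eps 0 \<omega>\<bar> powr p \<partial>M)"

lemma eps_moment_nonneg: "eps_moment \<ge> 0"
  by (simp add: eps_moment_def)

lemma eps_moment: "(\<integral>\<omega>. \<bar>eps i \<omega>\<bar> powr p \<partial>M) = eps_moment"
  using shift_one(1) [of "\<lambda>x. \<bar>x\<bar> powr p" i] by (simp add: eps_moment_def)

text \<open>In \<open>moment_increment\<close> the \<open>p\<close> of the first-order term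
  multiplies the \<open>2 * (p - 1)\<close> of the telescoping bound; in the second-order term
  \<open>p * (p - 1)\<close> occurs twice, for the sums with and without the new site.\<close>

definition moment_const :: real where
  "moment_const = 2 * p * (p - 1) * (dep_total + eps_moment powr (2 / p))"

lemma moment_const_nonneg: "moment_const \<ge> 0"
  unfolding moment_const_def using p_gt dep_total_nonneg by (auto intro!: mult_nonneg_nonneg add_nonneg_nonneg)

text \<open>The weighted new site is the increment in \<open>abs_powr_Taylor\<close>. Translated by
  \<open>- i\<close>, the sites of the first-order term become distinct elements of
  \<open>Vset 0 1\<close>, so the bound is uniform in \<open>i\<close> and \<open>\<Delta>\<close>;
  the square of the new site is handled by Hoelder.\<close>

lemma moment_increment:
  assumes fin: "finite \<Delta>" and i: "i \<notin> \<Delta>" and sub: "\<Delta> \<subseteq> Vset i 1"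
    and w: "\<And>j. \<bar>w j\<bar> \<le> 1" and m: "m > 0"
    and bound: "\<And>\<Delta>'. \<Delta>' \<subseteq> insert i \<Delta> \<Longrightarrow> (\<integral>\<omega>. \<bar>wsum w \<Delta>' 0 \<omega>\<bar> powr p \<partial>M) \<le> m"
  shows "(\<integral>\<omega>. \<bar>wsum w (insert i \<Delta>) 0 \<omega>\<bar> powr p \<partial>M)
    \<le> (\<integral>\<omega>. \<bar>wsum w \<Delta> 0 \<omega>\<bar> powr p \<partial>M) + moment_const * m powr ((p - 2) / p)"
proof -
  define T1 where "T1 = wsum w (insert i \<Delta>) 0"
  define T2 where "T2 = wsum w \<Delta> 0"
  have [measurable]: "T1 \<in> borel_measurable M" "T2 \<in> borel_measurable M"
    unfolding T1_def T2_def by measurable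
  have T12: "T1 \<omega> = T2 \<omega> + w i * eps i \<omega>" for \<omega>
    using fin i by (simp add: T1_def T2_def wsum_def)
  have Tint: "integrable M (\<lambda>\<omega>. \<bar>T1 \<omega>\<bar> powr p)" "integrable M (\<lambda>\<omega>. \<bar>T2 \<omega>\<bar> powr p)"
    unfolding T1_def T2_def using fin by (auto intro: wsum_Lp)
  have Tm: "(\<integral>\<omega>. \<bar>T1 \<omega>\<bar> powr p \<partial>M) \<le> m" "(\<integral>\<omega>. \<bar>T2 \<omega>\<bar> powr p \<partial>M) \<le> m"
    unfolding T1_def T2_def by (auto intro!: bound)
  have sq: "\<bar>(eps i \<omega>)\<^sup>2\<bar> powr (p / 2) = \<bar>eps i \<omega>\<bar> powr p" for \<omega>
    using powr_powr [of "\<bar>eps i \<omega>\<bar>" 2 "p / 2"] by simp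
  have Ap: "integrable M (\<lambda>\<omega>. \<bar>(eps i \<omega>)\<^sup>2\<bar> powr (p / 2))"
    "(\<integral>\<omega>. \<bar>(eps i \<omega>)\<^sup>2\<bar> powr (p / 2) \<partial>M) \<le> (eps_moment powr (2 / p)) powr (p / 2)"
    unfolding sq using eps_Lp p_gt eps_moment_nonneg by (auto simp: eps_moment powr_powr)
  have nn: "eps_moment powr (2 / p) \<ge> 0" by simp
  note H1 = Holder_powr [OF p_gt _ _ Ap Tint(1) Tm(1) nn m]
  note H2 = Holder_powr [OF p_gt _ _ Ap Tint(2) Tm(2) nn m]
  have pt: "\<bar>T1 \<omega>\<bar> powr p \<le> \<bar>T2 \<omega>\<bar> powr p + p * (spow (p - 1) (T2 \<omega>) * (w i * eps i \<omega>))
      + p * (p - 1) * (\<bar>(eps i \<omega>)\<^sup>2\<bar> * \<bar>T1 \<omega>\<bar> powr (p - 2) + \<bar>(eps i \<omega>)\<^sup>2\<bar> * \<bar>T2 \<omega>\<bar> powr (p - 2))" for \<omega>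
  proof -
    have "(w i * eps i \<omega>)\<^sup>2 \<le> (eps i \<omega>)\<^sup>2"
      using w [of i] mult_right_mono [of "(w i)\<^sup>2" 1 "(eps i \<omega>)\<^sup>2"] by (simp add: power_mult_distrib abs_square_le_1)
    then have "p * (p - 1) * ((w i * eps i \<omega>)\<^sup>2 * (\<bar>T1 \<omega>\<bar> powr (p - 2) + \<bar>T2 \<omega>\<bar> powr (p - 2)))
      \<le> p * (p - 1) * ((eps i \<omega>)\<^sup>2 * (\<bar>T1 \<omega>\<bar> powr (p - 2) + \<bar>T2 \<omega>\<bar> powr (p - 2)))"
      using p_gt by (intro mult_left_mono mult_right_mono) auto
    then show ?thesis
      using abs_powr_Taylor [OF p_gt, of "T2 \<omega>" "w i * eps i \<omega>"] unfolding T12 [symmetric]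
      by (simp add: distrib_left)
  qed
  have int: "integrable M (\<lambda>\<omega>. spow (p - 1) (T2 \<omega>) * (w i * eps i \<omega>))"
    using integrable_mult_right [OF spow_times_integrable [OF wsum_measurable meas wsum_Lp eps_Lp, of \<Delta> w 0 i], of "w i"] fin
    by (simp only: mult.left_commute T2_def)
  have "(\<integral>\<omega>. \<bar>T1 \<omega>\<bar> powr p \<partial>M) \<le> (\<integral>\<omega>. \<bar>T2 \<omega>\<bar> powr p + p * (spow (p - 1) (T2 \<omega>) * (w i * eps i \<omega>))
      + p * (p - 1) * (\<bar>(eps i \<omega>)\<^sup>2\<bar> * \<bar>T1 \<omega>\<bar> powr (p - 2) + \<bar>(eps i \<omega>)\<^sup>2\<bar> * \<bar>T2 \<omega>\<bar> powr (p - 2)) \<partial>M)"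
    using int H1(1) H2(1) Tint by (intro integral_mono pt) auto
  also have "\<dots> = (\<integral>\<omega>. \<bar>T2 \<omega>\<bar> powr p \<partial>M) + p * (\<integral>\<omega>. spow (p - 1) (T2 \<omega>) * (w i * eps i \<omega>) \<partial>M)
      + p * (p - 1) * ((\<integral>\<omega>. \<bar>(eps i \<omega>)\<^sup>2\<bar> * \<bar>T1 \<omega>\<bar> powr (p - 2) \<partial>M) + (\<integral>\<omega>. \<bar>(eps i \<omega>)\<^sup>2\<bar> * \<bar>T2 \<omega>\<bar> powr (p - 2) \<partial>M))"
    using int H1(1) H2(1) Tint by simp
  also have "\<dots> \<le> (\<integral>\<omega>. \<bar>T2 \<omega>\<bar> powr p \<partial>M) + p * (2 * (p - 1) * dep_total * m powr ((p - 2) / p))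
      + p * (p - 1) * (eps_moment powr (2 / p) * m powr ((p - 2) / p) + eps_moment powr (2 / p) * m powr ((p - 2) / p))"
  proof -
    have "(\<integral>\<omega>. spow (p - 1) (T2 \<omega>) * (w i * eps i \<omega>) \<partial>M)
      \<le> 2 * (p - 1) * (\<Sum>k\<in>\<Delta>. dep (k - i)) * m powr ((p - 2) / p)"
      unfolding T2_def by (intro spow_wsum_times_eps_le fin sub w m bound) auto
    also have "(\<Sum>k\<in>\<Delta>. dep (k - i)) = (\<Sum>k\<in>(\<lambda>k. k - i) ` \<Delta>. dep k)"
      by (subst sum.reindex) (auto simp: inj_on_def)
    also have "\<dots> \<le> dep_total"
      using fin sub by (intro sum_dep_le) (auto simp: Vset_def lex_less_diff)
    finally have "(\<integral>\<omega>. spow (p - 1) (T2 \<omega>) * (w i * eps i \<omega>) \<partial>M) \<le> 2 * (p - 1) * dep_total * m powr ((p - 2) / p)"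
      using p_gt by (simp add: mult_right_mono mult_left_mono)
    then show ?thesis
      using p_gt H1(2) H2(2) by (intro add_mono mult_left_mono order_refl) auto
  qed
  also have "\<dots> = (\<integral>\<omega>. \<bar>T2 \<omega>\<bar> powr p \<partial>M) + moment_const * m powr ((p - 2) / p)"
    by (simp add: moment_const_def algebra_simps)
  finally show ?thesis by (simp add: T1_def T2_def)
qed

text \<open>With \<open>m\<close> the largest \<open>p\<close>-th moment among all subsums, summing the increments gives
  \<open>m \<le> const * card \<Gamma> * m powr (1 - 2 / p)\<close>, which is solved for \<open>m\<close>.\<close>

lemma moment_inequality:
  assumes fin: "finite \<Gamma>" and w: "\<And>j. \<bar>w j\<bar> \<le> 1"
  shows "(\<integral>\<omega>. \<bar>wsum w \<Gamma> 0 \<omega>\<bar> powr p \<partial>M) \<le> (moment_const * real (card \<Gamma>)) powr (p / 2)"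
proof -
  define f where "f \<Delta> = (\<integral>\<omega>. \<bar>wsum w \<Delta> 0 \<omega>\<bar> powr p \<partial>M)" for \<Delta>
  define m where "m = Max (f ` Pow \<Gamma>)"
  have f_le: "f \<Delta> \<le> m" if "\<Delta> \<subseteq> \<Gamma>" for \<Delta>
    unfolding m_def using fin that by (intro Max_ge) auto
  show ?thesis
  proof (cases "m > 0")
    case False
    then have "f \<Gamma> \<le> 0" using f_le [of \<Gamma>] by simp
    also have "0 \<le> (moment_const * real (card \<Gamma>)) powr (p / 2)" by simp
    finally show ?thesis by (simp add: f_def)
  next
    case True
    have f_card: "f \<Delta> \<le> real (card \<Delta>) * (moment_const * m powr ((p - 2) / p))" if "\<Delta> \<subseteq> \<Gamma>" for \<Delta>
      using that
    proof (induction "card \<Delta>" arbitrary: \<Delta>)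
      case 0
      then have "\<Delta> = {}" using fin finite_subset by fastforce
      then show ?case by (simp add: f_def wsum_def)
    next
      case (Suc n)
      have finD: "finite \<Delta>" using fin Suc.prems finite_subset by blast
      have "\<Delta> \<noteq> {}" using Suc.hyps(2) by auto
      then obtain i where i: "i \<in> \<Delta>" "\<And>j. j \<in> \<Delta> - {i} \<Longrightarrow> lex_less j i"
        using finite_has_lex_max [OF finD] by blast
      have ins: "insert i (\<Delta> - {i}) = \<Delta>" using i by auto
      have "f (insert i (\<Delta> - {i})) \<le> f (\<Delta> - {i}) + moment_const * m powr ((p - 2) / p)"
        unfolding f_def
        using finD i w True f_le Suc.prems
        by (intro moment_increment) (auto simp: f_def [symmetric] intro!: lex_less_imp_Vset_1 f_le)
      also have "f (\<Delta> - {i}) \<le> real (card (\<Delta> - {i})) * (moment_const * m powr ((p - 2) / p))"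
        using Suc finD i by (intro Suc.hyps(1)) auto
      also have "real (card (\<Delta> - {i})) = real (card \<Delta>) - 1"
        using finD i card_gt_0_iff [of \<Delta>] by (auto simp: of_nat_diff)
      finally show ?case unfolding ins by (simp add: algebra_simps)
    qed
    have "m \<in> f ` Pow \<Gamma>" unfolding m_def using fin by (intro Max_in) auto
    then obtain \<Delta> where D: "\<Delta> \<subseteq> \<Gamma>" "m = f \<Delta>" by auto
    have "m \<le> real (card \<Delta>) * (moment_const * m powr ((p - 2) / p))" using f_card [OF D(1)] D(2) by simp
    also have "\<dots> \<le> real (card \<Gamma>) * (moment_const * m powr ((p - 2) / p))"
      using card_mono [OF fin D(1)] moment_const_nonneg by (intro mult_right_mono) auto
    finally have "m powr (- ((p - 2) / p)) * m \<le> m powr (- ((p - 2) / p)) * (real (card \<Gamma>) * (moment_const * m powr ((p - 2) / p)))"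
      by (intro mult_left_mono) auto
    also have "\<dots> = moment_const * real (card \<Gamma>)"
      using True by (simp add: powr_minus field_simps)
    also have "m powr (- ((p - 2) / p)) * m = m powr (2 / p)"
    proof -
      have "m powr (- ((p - 2) / p)) * m powr 1 = m powr (- ((p - 2) / p) + 1)" by (rule powr_add [symmetric])
      also have "- ((p - 2) / p) + 1 = 2 / p" using p_gt by (simp add: field_simps)
      finally show ?thesis using True by simp
    qed
    finally have "(m powr (2 / p)) powr (p / 2) \<le> (moment_const * real (card \<Gamma>)) powr (p / 2)"
      using p_gt by (intro powr_mono2) auto
    then have "m \<le> (moment_const * real (card \<Gamma>)) powr (p / 2)"
      using p_gt True by (simp add: powr_powr)
    then show ?thesis using f_le [of \<Gamma>] by (simp add: f_def)
  qed
qed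

end

section \<open>Dyadic decomposition of boxes\<close>

lemma prod_indicator:
  "(\<Prod>l\<in>UNIV. indicator (A l) (y l) :: real) = (if \<forall>l::'d::finite. y l \<in> A l then 1 else 0)"
  by (auto intro: prod_zero simp: indicator_def)

lemma card_vec_box:
  fixes A :: "'d::finite \<Rightarrow> int set"
  assumes "\<And>l. finite (A l)"
  shows "finite {i::(int, 'd) vec. \<forall>l. i $ l - s l \<in> A l}"
    and "card {i::(int, 'd) vec. \<forall>l. i $ l - s l \<in> A l} = (\<Prod>l\<in>UNIV. card (A l))"
proof -
  have "bij_betw (\<lambda>f. (\<chi> l. f l + s l)) (Pi\<^sub>E UNIV A) {i::(int, 'd) vec. \<forall>l. i $ l - s l \<in> A l}"
    by (rule bij_betw_byWitness [where f' = "\<lambda>i l. i $ l - s l"]) (auto simp: vec_eq_iff)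
  moreover have "finite (Pi\<^sub>E UNIV A)" using assms by (intro finite_PiE) auto
  ultimately show "finite {i::(int, 'd) vec. \<forall>l. i $ l - s l \<in> A l}"
    "card {i::(int, 'd) vec. \<forall>l. i $ l - s l \<in> A l} = (\<Prod>l\<in>UNIV. card (A l))"
    by (auto simp: bij_betw_finite card_PiE dest: bij_betw_same_card)
qed

text \<open>Writing \<open>v\<close> in binary, the interval from \<open>0\<close> to \<open>v\<close> is the disjoint union over \<open>j\<close>
  of the intervals \<open>dyadic_piece j (v div 2 ^ j)\<close>; the one of index \<open>j\<close> is empty
  or has length \<open>2 ^ j\<close> according to the \<open>j\<close>-th binary digit.\<close>

definition dyadic_piece :: "nat \<Rightarrow> nat \<Rightarrow> int set" where
  "dyadic_piece j q = {int ((q - q mod 2) * 2 ^ j) ..< int (q * 2 ^ j)}"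

definition dyadic_index :: "nat \<Rightarrow> (nat \<times> nat) set" where
  "dyadic_index J = (SIGMA j:{..J}. {..2 ^ (J - j)})"

lemma finite_dyadic_index: "finite (dyadic_index J)"
  by (simp add: dyadic_index_def)

lemma finite_dyadic_piece: "finite (dyadic_piece j q)"
  by (simp add: dyadic_piece_def)

lemma card_dyadic_piece: "card (dyadic_piece j q) \<le> 2 ^ j"
proof -
  have "card {int a..<int b} = b - a" for a b by simp
  then have "card (dyadic_piece j q) = (q - (q - q mod 2)) * 2 ^ j"
    unfolding dyadic_piece_def diff_mult_distrib .
  also have "\<dots> \<le> 1 * 2 ^ j" by (intro mult_right_mono) auto
  finally show ?thesis by simp
qed

lemma dyadic_piece_subset:
  assumes "(j, q) \<in> dyadic_index J"
  shows "dyadic_piece j q \<subseteq> {0..<2 ^ J}"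
proof -
  have "q * 2 ^ j \<le> 2 ^ (J - j) * 2 ^ j" "j \<le> J"
    using assms by (auto simp: dyadic_index_def)
  then have "q * 2 ^ j \<le> 2 ^ J" by (simp flip: power_add)
  then have "int (q * 2 ^ j) \<le> int (2 ^ J)" by (subst of_nat_le_iff)
  then have "int (q * 2 ^ j) \<le> 2 ^ J" by simp
  then show ?thesis unfolding dyadic_piece_def
    by (auto simp del: of_nat_mult intro: order.trans [OF of_nat_0_le_iff] less_le_trans)
qed

lemma div_in_dyadic_index:
  assumes "v \<le> 2 ^ J" "j \<le> J"
  shows "(j, v div 2 ^ j) \<in> dyadic_index J"
proof -
  have "v div 2 ^ j \<le> 2 ^ J div 2 ^ j" using assms by (intro div_le_mono)
  also have "\<dots> = 2 ^ (J - j)" using assms by (simp add: power_diff)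
  finally show ?thesis using assms by (simp add: dyadic_index_def)
qed

lemma less_eq_sum_dyadic:
  assumes v: "v \<le> 2 ^ J" and t: "t \<ge> 0"
  shows "(if t < int v then 1 else 0 :: real) = (\<Sum>j\<le>J. indicator (dyadic_piece j (v div 2 ^ j)) t)"
proof -
  \<comment> \<open>\<open>a j\<close> is \<open>v\<close> rounded down to a multiple of
    \<open>2 ^ j\<close>. The piece at scale \<open>j\<close> lies between consecutive roundings, so
    the sum telescopes from \<open>a 0 = v\<close> down to \<open>a (Suc J) = 0\<close>.\<close>
  define a where "a j = int (v div 2 ^ j * 2 ^ j)" for j
  define b where "b j = (if t < a j then 1 else 0 :: real)" for j
  have "dyadic_piece j (v div 2 ^ j) = {a (Suc j)..<a j}" for j
  proof -
    have "v div 2 ^ j - v div 2 ^ j mod 2 = 2 * (v div 2 ^ Suc j)"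
      by (simp only: minus_mod_eq_mult_div div_mult2_eq power_Suc2)
    then show ?thesis by (simp add: dyadic_piece_def a_def mult_ac)
  qed
  moreover have "a (Suc j) \<le> a j" for j
  proof -
    have "v div 2 ^ Suc j * 2 ^ Suc j = v div 2 ^ j div 2 * 2 * 2 ^ j"
      by (simp only: power_Suc2 div_mult2_eq mult.assoc mult.commute [of 2])
    also have "\<dots> \<le> v div 2 ^ j * 2 ^ j" by (intro mult_right_mono) auto
    finally show ?thesis unfolding a_def by (subst of_nat_le_iff)
  qed
  ultimately have "indicator (dyadic_piece j (v div 2 ^ j)) t = b j - b (Suc j)" for j
    by (auto simp: b_def indicator_def not_less intro: order.trans less_le_trans)
  then have "(\<Sum>j\<le>J. indicator (dyadic_piece j (v div 2 ^ j)) t) = b 0 - b (Suc J)"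
    by (simp add: sum_telescope)
  moreover have "v < 2 ^ Suc J" using v by (simp add: le_less_trans [of v "2 ^ J"])
  then have "b (Suc J) = 0" using t by (simp add: b_def a_def del: power_Suc)
  ultimately show ?thesis by (simp add: b_def a_def)
qed

text \<open>The interval is a difference of two initial segments; the Boolean selects the endpoint
  and with it the sign.\<close>

lemma indicator_eq_sum_dyadic:
  assumes uv: "u \<le> v" "v \<le> 2 ^ J" and t: "t \<ge> 0"
  shows "(indicator {int u..<int v} t :: real) = (\<Sum>(j, b)\<in>{..J} \<times> (UNIV :: bool set).
    (if b then 1 else - 1) * indicator (dyadic_piece j ((if b then v else u) div 2 ^ j)) t)"
proof -
  have bool: "sum f (UNIV :: bool set) = f True + f False" for f :: "bool \<Rightarrow> real"
    by (simp add: UNIV_bool)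
  have "(indicator {int u..<int v} t :: real) = (if t < int v then 1 else 0) - (if t < int u then 1 else 0)"
    using uv by (auto simp: indicator_def)
  also have "\<dots> = (\<Sum>j\<le>J. \<Sum>b\<in>(UNIV :: bool set).
    (if b then 1 else - 1) * indicator (dyadic_piece j ((if b then v else u) div 2 ^ j)) t)"
    using uv t bool by (simp add: less_eq_sum_dyadic [of _ J] sum_subtractf del: sum_mult_indicator)
  finally show ?thesis by (simp only: sum.cartesian_product)
qed

definition dyadic_box :: "('d::finite \<Rightarrow> int) \<Rightarrow> ('d \<Rightarrow> nat \<times> nat) \<Rightarrow> (int, 'd) vec set" where
  "dyadic_box s f = {i. \<forall>l. i $ l - s l \<in> dyadic_piece (fst (f l)) (snd (f l))}"

lemma finite_dyadic_box: "finite (dyadic_box s f)"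
  unfolding dyadic_box_def by (intro card_vec_box finite_dyadic_piece)

lemma card_dyadic_box: "card (dyadic_box s f) = (\<Prod>l\<in>UNIV. card (dyadic_piece (fst (f l)) (snd (f l))))"
  unfolding dyadic_box_def by (intro card_vec_box finite_dyadic_piece)

abbreviation dyadic_boxes :: "nat \<Rightarrow> ('d::finite \<Rightarrow> nat \<times> nat) set" where
  "dyadic_boxes J \<equiv> Pi\<^sub>E UNIV (\<lambda>_. dyadic_index J)"

lemma finite_dyadic_boxes: "finite (dyadic_boxes J)"
  by (intro finite_PiE finite_dyadic_index) auto

text \<open>The right side does not involve \<open>u\<close> and \<open>v\<close>: one random
  variable will serve all boxes at once. Multiplying the one-dimensional decompositions writes a box
  as a signed combination of \<open>(2 * (J + 1)) ^ d\<close> dyadic boxes, and the largest dyadic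
  sum is dominated by the sum of \<open>p\<close>-th powers.\<close>

lemma box_sum_le:
  fixes x :: "(int, 'd::finite) vec \<Rightarrow> real" and u v :: "'d \<Rightarrow> nat"
  assumes uv: "\<And>l. u l \<le> v l" "\<And>l. v l \<le> 2 ^ J" and p: "p > 0"
  shows "\<bar>\<Sum>i | \<forall>l. i $ l - s l \<in> {int (u l)..<int (v l)}. x i\<bar>
    \<le> (2 * (real J + 1)) ^ CARD('d) * (\<Sum>f\<in>dyadic_boxes J. \<bar>\<Sum>i\<in>dyadic_box s f. x i\<bar> powr p) powr (1 / p)"
proof -
  define W where "W = {i::(int, 'd) vec. \<forall>l. i $ l - s l \<in> {0..<2 ^ J}}"
  have finW: "finite W" unfolding W_def by (intro card_vec_box) auto
  define Q where "Q = {..J} \<times> (UNIV :: bool set)"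
  define sg where "sg b = (if b then 1 else - 1 :: real)" for b
  \<comment> \<open>A choice \<open>g\<close> names a scale and an endpoint in each coordinate;
    \<open>F g\<close> is the index of the resulting dyadic box.\<close>
  define F where "F g l = (fst (g l), (if snd (g l) then v l else u l) div 2 ^ fst (g l))" for g :: "'d \<Rightarrow> nat \<times> bool" and l
  define Z where "Z = (\<Sum>f\<in>dyadic_boxes J. \<bar>\<Sum>i\<in>dyadic_box s f. x i\<bar> powr p) powr (1 / p)"
  let ?B = "{i::(int, 'd) vec. \<forall>l. i $ l - s l \<in> {int (u l)..<int (v l)}}"
  have u: "u l \<le> 2 ^ J" for l using uv(1) [of l] uv(2) [of l] by simp
  have Fin: "F g \<in> dyadic_boxes J" if "g \<in> Pi\<^sub>E UNIV (\<lambda>_. Q)" for g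
  proof (rule PiE_I)
    fix l
    have "fst (g l) \<le> J" using that by (auto simp: Q_def PiE_iff mem_Times_iff)
    then show "F g l \<in> dyadic_index J" unfolding F_def using uv(2) u by (intro div_in_dyadic_index) auto
  qed simp
  have boxW: "dyadic_box s f \<subseteq> W" if "f \<in> dyadic_boxes J" for f
  proof -
    have "dyadic_piece (fst (f l)) (snd (f l)) \<subseteq> {0..<2 ^ J}" for l
      using that by (intro dyadic_piece_subset) (auto simp: PiE_iff)
    then show ?thesis unfolding dyadic_box_def W_def by blast
  qed
  have BW: "?B \<subseteq> W"
  proof -
    have "int (v l) \<le> 2 ^ J" for l using uv(2) [of l] by (metis of_nat_le_iff of_nat_numeral of_nat_power)
    then have "{int (u l)..<int (v l)} \<subseteq> {0..<2 ^ J}" for l by (auto intro: less_le_trans)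
    then show ?thesis unfolding W_def by blast
  qed
  have ind: "(\<Prod>l\<in>UNIV. indicator {int (u l)..<int (v l)} (i $ l - s l) :: real)
      = (\<Sum>g\<in>Pi\<^sub>E UNIV (\<lambda>_. Q). (\<Prod>l\<in>UNIV. sg (snd (g l))) * indicator (dyadic_box s (F g)) i)"
    if "i \<in> W" for i
  proof -
    have "(\<Prod>l\<in>UNIV. indicator {int (u l)..<int (v l)} (i $ l - s l) :: real)
      = (\<Prod>l\<in>UNIV. \<Sum>jb\<in>Q. sg (snd jb) * indicator (dyadic_piece (fst jb) ((if snd jb then v l else u l) div 2 ^ fst jb)) (i $ l - s l))"
    proof (intro prod.cong refl)
      fix l
      show "(indicator {int (u l)..<int (v l)} (i $ l - s l) :: real)
      = (\<Sum>jb\<in>Q. sg (snd jb) * indicator (dyadic_piece (fst jb) ((if snd jb then v l else u l) div 2 ^ fst jb)) (i $ l - s l))"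
        using indicator_eq_sum_dyadic [OF uv(1) uv(2), of "i $ l - s l" l] that
        by (simp add: Q_def sg_def W_def split_beta)
    qed
    also have "\<dots> = (\<Sum>g\<in>Pi\<^sub>E UNIV (\<lambda>_. Q). \<Prod>l\<in>UNIV. sg (snd (g l)) * indicator (dyadic_piece (fst (g l)) ((if snd (g l) then v l else u l) div 2 ^ fst (g l))) (i $ l - s l))"
      by (intro prod_sum_PiE) (auto simp: Q_def)
    also have "\<dots> = (\<Sum>g\<in>Pi\<^sub>E UNIV (\<lambda>_. Q). (\<Prod>l\<in>UNIV. sg (snd (g l))) * indicator (dyadic_box s (F g)) i)"
      by (intro sum.cong refl) (auto simp: prod.distrib F_def dyadic_box_def prod_indicator)
    finally show ?thesis .
  qed
  have term_le: "\<bar>(\<Prod>l\<in>UNIV. sg (snd (g l))) * (\<Sum>i\<in>dyadic_box s (F g). x i)\<bar> \<le> Z"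
    if g: "g \<in> Pi\<^sub>E UNIV (\<lambda>_. Q)" for g
  proof -
    have "\<bar>(\<Prod>l\<in>UNIV. sg (snd (g l))) * (\<Sum>i\<in>dyadic_box s (F g). x i)\<bar> = \<bar>\<Sum>i\<in>dyadic_box s (F g). x i\<bar>"
    proof -
      have "\<bar>sg b\<bar> = 1" for b by (simp add: sg_def)
      then show ?thesis by (simp add: abs_mult abs_prod)
    qed
    also have "\<dots> = (\<bar>\<Sum>i\<in>dyadic_box s (F g). x i\<bar> powr p) powr (1 / p)" using p by (simp add: powr_powr)
    also have "\<dots> \<le> Z" unfolding Z_def using p Fin [OF g] finite_dyadic_boxes
      by (intro powr_mono2 member_le_sum) auto
    finally show ?thesis .
  qed
  have "(\<Sum>i\<in>?B. x i) = (\<Sum>i\<in>W. (\<Prod>l\<in>UNIV. indicator {int (u l)..<int (v l)} (i $ l - s l)) * x i)"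
    using finW BW by (intro sum.mono_neutral_cong_left) (auto simp: indicator_def)
  also have "\<dots> = (\<Sum>i\<in>W. \<Sum>g\<in>Pi\<^sub>E UNIV (\<lambda>_. Q). (\<Prod>l\<in>UNIV. sg (snd (g l))) * (indicator (dyadic_box s (F g)) i * x i))"
    by (simp add: ind sum_distrib_right mult.assoc)
  also have "\<dots> = (\<Sum>g\<in>Pi\<^sub>E UNIV (\<lambda>_. Q). (\<Prod>l\<in>UNIV. sg (snd (g l))) * (\<Sum>i\<in>W. indicator (dyadic_box s (F g)) i * x i))"
    by (subst sum.swap) (simp add: sum_distrib_left)
  also have "\<dots> = (\<Sum>g\<in>Pi\<^sub>E UNIV (\<lambda>_. Q). (\<Prod>l\<in>UNIV. sg (snd (g l))) * (\<Sum>i\<in>dyadic_box s (F g). x i))"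
    by (intro sum.cong refl arg_cong2 [where f = "(*)"] sum.mono_neutral_cong_right finW boxW Fin) auto
  also have "\<bar>\<dots>\<bar> \<le> (\<Sum>g\<in>Pi\<^sub>E UNIV (\<lambda>_::'d. Q). Z)"
    by (rule order.trans [OF sum_abs]) (intro sum_mono term_le)
  also have "\<dots> = (2 * (real J + 1)) ^ CARD('d) * Z"
    by (simp add: card_PiE Q_def card_cartesian_product mult.commute add.commute)
  finally show ?thesis by (simp add: Z_def)
qed

text \<open>The sum factorises over coordinates. At scale \<open>j\<close> there are
  \<open>2 ^ (J - j) + 1\<close> pieces of length at most \<open>2 ^ j\<close>; since
  \<open>p / 2 \<ge> 1\<close>, together they cost at most twice a single interval of length
  \<open>2 ^ J\<close>. The number \<open>J + 1\<close> of scales is the logarithmic loss.\<close>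

lemma sum_card_dyadic_boxes_le:
  assumes p: "p \<ge> 2"
  shows "(\<Sum>f\<in>dyadic_boxes J. real (card (dyadic_box s (f :: 'd::finite \<Rightarrow> _))) powr (p / 2))
    \<le> (2 * (real J + 1) * (2 ^ J) powr (p / 2)) ^ CARD('d)"
proof -
  have "(\<Sum>f\<in>dyadic_boxes J. real (card (dyadic_box s f)) powr (p / 2))
    = (\<Sum>f\<in>dyadic_boxes J. \<Prod>l\<in>(UNIV :: 'd set). real (card (dyadic_piece (fst (f l)) (snd (f l)))) powr (p / 2))"
    by (simp add: card_dyadic_box prod_powr_distrib)
  also have "\<dots> = (\<Prod>l\<in>(UNIV :: 'd set). \<Sum>jq\<in>dyadic_index J. real (card (dyadic_piece (fst jq) (snd jq))) powr (p / 2))"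
    by (intro prod_sum_PiE [symmetric] finite_dyadic_index) auto
  also have "\<dots> = (\<Sum>jq\<in>dyadic_index J. real (card (dyadic_piece (fst jq) (snd jq))) powr (p / 2)) ^ CARD('d)"
    by simp
  also have "\<dots> \<le> (2 * (real J + 1) * (2 ^ J) powr (p / 2)) ^ CARD('d)"
  proof (intro power_mono sum_nonneg)
    have "(\<Sum>jq\<in>dyadic_index J. real (card (dyadic_piece (fst jq) (snd jq))) powr (p / 2))
      = (\<Sum>j\<le>J. \<Sum>q\<le>2 ^ (J - j). real (card (dyadic_piece j q)) powr (p / 2))"
      unfolding dyadic_index_def by (subst sum.Sigma) (auto simp: split_beta)
    also have "\<dots> \<le> (\<Sum>j\<le>J. \<Sum>q::nat\<le>2 ^ (J - j). (2 ^ j) powr (p / 2))"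
    proof (intro sum_mono powr_mono2)
      fix j q
      show "real (card (dyadic_piece j q)) \<le> 2 ^ j"
        using card_dyadic_piece [of j q] by (metis of_nat_le_iff of_nat_numeral of_nat_power)
    qed (use p in auto)
    also have "\<dots> \<le> (\<Sum>j\<le>J. 2 * (2 ^ J) powr (p / 2))"
    proof (intro sum_mono)
      fix j assume j: "j \<in> {..J}"
      have "(\<Sum>q::nat\<le>2 ^ (J - j). (2 ^ j) powr (p / 2)) = (2 ^ (J - j) + 1) * (2 ^ j) powr (p / 2)"
        by simp
      also have "\<dots> \<le> (2 * 2 ^ (J - j)) * (2 ^ j) powr (p / 2)"
        by (intro mult_right_mono) auto
      also have "\<dots> \<le> (2 * (2 ^ (J - j)) powr (p / 2)) * (2 ^ j) powr (p / 2)"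
        using powr_mono [of 1 "p / 2" "2 ^ (J - j)"] p by (intro mult_right_mono) auto
      also have "\<dots> = 2 * (2 ^ (J - j) * 2 ^ j) powr (p / 2)" by (simp add: powr_mult)
      also have "\<dots> = 2 * (2 ^ J) powr (p / 2)" using j by (simp flip: power_add)
      finally show "(\<Sum>q::nat\<le>2 ^ (J - j). (2 ^ j) powr (p / 2)) \<le> 2 * (2 ^ J) powr (p / 2)" .
    qed
    finally show "(\<Sum>jq\<in>dyadic_index J. real (card (dyadic_piece (fst jq) (snd jq))) powr (p / 2))
       \<le> 2 * (real J + 1) * (2 ^ J) powr (p / 2)"
      by (simp add: algebra_simps)
  qed auto
  finally show ?thesis .
qed

context stationary_C3_field
begin

lemma dyadic_moment:
  assumes w: "\<And>j. \<bar>w j\<bar> \<le> 1"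
  shows "integrable M (\<lambda>\<omega>. \<Sum>f\<in>dyadic_boxes J. \<bar>wsum w (dyadic_box s f) 0 \<omega>\<bar> powr p)"
    and "(\<integral>\<omega>. (\<Sum>f\<in>dyadic_boxes J. \<bar>wsum w (dyadic_box s f) 0 \<omega>\<bar> powr p) \<partial>M)
      \<le> moment_const powr (p / 2) * (2 * (real J + 1) * (2 ^ J) powr (p / 2)) ^ CARD('d)"
proof -
  show "integrable M (\<lambda>\<omega>. \<Sum>f\<in>dyadic_boxes J. \<bar>wsum w (dyadic_box s f) 0 \<omega>\<bar> powr p)"
    by (intro Bochner_Integration.integrable_sum wsum_Lp finite_dyadic_box)
  have "(\<integral>\<omega>. (\<Sum>f\<in>dyadic_boxes J. \<bar>wsum w (dyadic_box s f) 0 \<omega>\<bar> powr p) \<partial>M)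
    = (\<Sum>f\<in>dyadic_boxes J. \<integral>\<omega>. \<bar>wsum w (dyadic_box s f) 0 \<omega>\<bar> powr p \<partial>M)"
    by (intro Bochner_Integration.integral_sum wsum_Lp finite_dyadic_box)
  also have "\<dots> \<le> (\<Sum>f\<in>dyadic_boxes J. (moment_const * real (card (dyadic_box s f))) powr (p / 2))"
    by (intro sum_mono moment_inequality finite_dyadic_box w)
  also have "\<dots> = moment_const powr (p / 2) * (\<Sum>f\<in>dyadic_boxes J. real (card (dyadic_box s f)) powr (p / 2))"
    using moment_const_nonneg by (simp add: powr_mult sum_distrib_left)
  also have "\<dots> \<le> moment_const powr (p / 2) * (2 * (real J + 1) * (2 ^ J) powr (p / 2)) ^ CARD('d)"
    using p_gt by (intro mult_left_mono sum_card_dyadic_boxes_le) auto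
  finally show "(\<integral>\<omega>. (\<Sum>f\<in>dyadic_boxes J. \<bar>wsum w (dyadic_box s f) 0 \<omega>\<bar> powr p) \<partial>M)
      \<le> moment_const powr (p / 2) * (2 * (real J + 1) * (2 ^ J) powr (p / 2)) ^ CARD('d)" .
qed

end

section \<open>The kernel weights\<close>

lemma maxnorm_le_iff: "maxnorm x \<le> r \<longleftrightarrow> (\<forall>l. \<bar>x $ l\<bar> \<le> r)"
  unfolding maxnorm_def by (subst Max_le_iff) auto

definition clamp_cube :: "(real, 'd::finite) vec \<Rightarrow> (real, 'd) vec" where
  "clamp_cube x = (\<chi> l. max (- 1) (min 1 (x $ l)))"

lemma maxnorm_clamp_cube: "maxnorm (clamp_cube x) \<le> 1"
  by (auto simp: maxnorm_le_iff clamp_cube_def)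

lemma clamp_cube_id: "maxnorm x \<le> 1 \<Longrightarrow> clamp_cube x = x"
  by (auto simp: maxnorm_le_iff clamp_cube_def vec_eq_iff abs_le_iff max_def min_def intro: antisym)

lemma maxnorm_clamp_cube_diff: "maxnorm (clamp_cube x - clamp_cube y) \<le> maxnorm (x - y)"
proof -
  have "\<bar>x $ l - y $ l\<bar> \<le> maxnorm (x - y)" for l
    using maxnorm_le_iff [of "x - y" "maxnorm (x - y)"] by simp
  moreover have "\<bar>clamp_cube x $ l - clamp_cube y $ l\<bar> \<le> \<bar>x $ l - y $ l\<bar>" for l
    by (auto simp: clamp_cube_def max_def min_def abs_if)
  ultimately show ?thesis
    unfolding maxnorm_le_iff by (auto intro: order.trans)
qed

lemma Lam_eq: "Lam n = {i. \<forall>l. i $ l - 0 \<in> {1..int n}}"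
  by (auto simp: Lam_def)

lemma finite_Lam: "finite (Lam n :: (int, 'd::finite) vec set)"
  unfolding Lam_eq by (rule card_vec_box) auto

lemma card_Lam: "card (Lam n :: (int, 'd::finite) vec set) = n ^ CARD('d)"
  unfolding Lam_eq by (subst card_vec_box) auto

definition design_arg :: "nat \<Rightarrow> real \<Rightarrow> (real, 'd::finite) vec \<Rightarrow> (int, 'd) vec \<Rightarrow> (real, 'd) vec" where
  "design_arg n h x i = (1 / h) *\<^sub>R (x - (1 / real n) *\<^sub>R ivec i)"

text \<open>The condition separates into one interval per coordinate, so the sites seen from
  \<open>x\<close> form a box, the shape that \<open>box_sum_le\<close> handles.\<close>

lemma maxnorm_design_arg_le:
  assumes "h > 0" "n > 0"
  shows "maxnorm (design_arg n h x i) \<le> 1 \<longleftrightarrow>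
    (\<forall>l. real n * (x $ l - h) \<le> real_of_int (i $ l) \<and> real_of_int (i $ l) \<le> real n * (x $ l + h))"
proof -
  have "\<bar>(1 / h) * (a - (1 / real n) * b)\<bar> \<le> 1 \<longleftrightarrow> real n * (a - h) \<le> b \<and> b \<le> real n * (a + h)" for a b
  proof -
    have "\<bar>(1 / h) * (a - (1 / real n) * b)\<bar> = \<bar>real n * a - b\<bar> / (real n * h)"
      using assms by (simp add: abs_mult field_simps flip: abs_divide) (simp add: abs_if field_simps)
    also have "\<dots> \<le> 1 \<longleftrightarrow> \<bar>real n * a - b\<bar> \<le> real n * h" using assms by (simp add: divide_le_eq)
    finally show ?thesis by (auto simp: abs_le_iff algebra_simps)
  qed
  then show ?thesis unfolding maxnorm_le_iff by (simp add: design_arg_def ivec_def)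
qed

locale kernel =
  fixes K :: "(real, 'd::finite) vec \<Rightarrow> real" and \<eta> c C :: real
  assumes K_nonneg: "\<And>x. K x \<ge> 0"
    and K_supp: "\<And>x. maxnorm x > 1 \<Longrightarrow> K x = 0"
    and \<eta>_pos: "\<eta> > 0"
    and K_lip: "\<And>x y. maxnorm x \<le> 1 \<Longrightarrow> maxnorm y \<le> 1 \<Longrightarrow> \<bar>K x - K y\<bar> \<le> \<eta> * maxnorm (x - y)"
    and c_pos: "c > 0" and C_pos: "C > 0"
    and K_bounds: "\<And>x. maxnorm x \<le> 1 \<Longrightarrow> c \<le> K x \<and> K x \<le> C"
begin

text \<open>\<open>K\<close> jumps on the boundary of its support; \<open>Kext\<close> extends its restriction to the cube to a globally
  Lipschitz function, so that all discontinuity is carried by the indicator of a box.\<close>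

definition Kext :: "(real, 'd) vec \<Rightarrow> real" where
  "Kext x = K (clamp_cube x)"

lemma Kext_bounds: "0 \<le> Kext x" "Kext x \<le> C"
  using K_bounds [OF maxnorm_clamp_cube, of x] K_nonneg by (auto simp: Kext_def)

lemma Kext_lip: "\<bar>Kext x - Kext y\<bar> \<le> \<eta> * maxnorm (x - y)"
proof -
  have "\<bar>Kext x - Kext y\<bar> \<le> \<eta> * maxnorm (clamp_cube x - clamp_cube y)"
    unfolding Kext_def by (intro K_lip maxnorm_clamp_cube)
  also have "\<dots> \<le> \<eta> * maxnorm (x - y)"
    using \<eta>_pos by (intro mult_left_mono maxnorm_clamp_cube_diff) auto
  finally show ?thesis .
qed

lemma K_eq_Kext: "maxnorm x \<le> 1 \<Longrightarrow> K x = Kext x"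
  by (simp add: Kext_def clamp_cube_id)

text \<open>Near the boundary of the unit cube part of the window contains no design points. In
  every coordinate one half of the window stays inside, and only that half is counted.\<close>

lemma kernel_sum_ge:
  assumes h: "h > 0" "h \<le> 1 / 2" and nh: "real n * h \<ge> 2" and x: "x \<in> unit_cube"
  shows "(\<Sum>i\<in>Lam n. K (design_arg n h x i)) \<ge> c * (real n * h / 2) ^ CARD('d)"
proof -
  have n: "n > 0" using nh by (cases n) auto
  \<comment> \<open>Left end of an interval of length \<open>n h\<close>, placed to the right of
    \<open>n x\<close> in the lower half of the cube and to the left in the upper half;
    \<open>h \<le> 1 / 2\<close> keeps it between 0 and \<open>n\<close>.\<close>
  define y where "y l = real n * (if x $ l \<le> 1 / 2 then x $ l else x $ l - h)" for l
  have x01: "0 \<le> x $ l" "x $ l \<le> 1" for l using x by (auto simp: unit_cube_def)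
  \<comment> \<open>Starting strictly above \<open>y l\<close> excludes the index 0 when
    \<open>y l = 0\<close>, since sites are numbered from 1.\<close>
  define A where "A l = {\<lfloor>y l\<rfloor> + 1..\<lfloor>y l + real n * h\<rfloor>}" for l
  define B where "B = {i::(int, 'd) vec. \<forall>l. i $ l - 0 \<in> A l}"
  have y0: "0 \<le> y l" for l using x01 [of l] h by (auto simp: y_def)
  have y1: "y l + real n * h \<le> real n" for l
  proof -
    have "y l + real n * h \<le> real n * 1"
      unfolding y_def distrib_left [symmetric] using x01 [of l] h by (intro mult_left_mono) auto
    then show ?thesis by simp
  qed
  have ylo: "real n * (x $ l - h) \<le> y l" for l
    unfolding y_def using h by (intro mult_left_mono) auto
  have yhi: "y l + real n * h \<le> real n * (x $ l + h)" for l
    unfolding y_def distrib_left [symmetric] using h by (intro mult_left_mono) auto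
  have A: "1 \<le> t" "t \<le> int n" "real n * (x $ l - h) \<le> real_of_int t" "real_of_int t \<le> real n * (x $ l + h)"
    if "t \<in> A l" for t l
  proof -
    have t: "y l \<le> real_of_int t" "real_of_int t \<le> y l + real n * h" "\<lfloor>y l\<rfloor> < t"
      using that unfolding A_def by (auto simp: le_floor_iff) linarith
    then show "1 \<le> t" using y0 [of l] by linarith
    show "t \<le> int n" using t y1 [of l] by linarith
    show "real n * (x $ l - h) \<le> real_of_int t" "real_of_int t \<le> real n * (x $ l + h)"
      using t ylo [of l] yhi [of l] by linarith+
  qed
  have sub: "B \<subseteq> Lam n" by (auto simp: B_def Lam_def intro: A)
  have inner: "maxnorm (design_arg n h x i) \<le> 1" if "i \<in> B" for i
    using that unfolding maxnorm_design_arg_le [OF h(1) n] by (auto simp: B_def intro: A)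
  have "(real n * h / 2) ^ CARD('d) = (\<Prod>l\<in>(UNIV::'d set). real n * h / 2)" by simp
  also have "\<dots> \<le> (\<Prod>l\<in>UNIV. real (card (A l)))"
  proof (intro prod_mono conjI)
    fix l
    \<comment> \<open>Rounding loses at most one site, and \<open>n h \<ge> 2\<close> makes this at
      most half of the interval.\<close>
    have "real n * h / 2 \<le> real n * h - 1" using nh by linarith
    also have "\<dots> \<le> real_of_int (\<lfloor>y l + real n * h\<rfloor> - \<lfloor>y l\<rfloor>)" by linarith
    also have "\<dots> \<le> real (card (A l))" by (simp add: A_def) 
    finally show "real n * h / 2 \<le> real (card (A l))" .
  qed (use h in auto)
  also have "\<dots> = real (card B)" unfolding B_def by (subst card_vec_box) (auto simp: A_def)
  finally have "c * (real n * h / 2) ^ CARD('d) \<le> c * real (card B)" using c_pos by simp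
  also have "\<dots> = (\<Sum>i\<in>B. c)" by simp
  also have "\<dots> \<le> (\<Sum>i\<in>B. K (design_arg n h x i))" using inner K_bounds by (intro sum_mono) auto
  also have "\<dots> \<le> (\<Sum>i\<in>Lam n. K (design_arg n h x i))"
    using sub finite_Lam K_nonneg by (intro sum_mono2) auto
  finally show ?thesis .
qed

definition grid_point :: "nat \<Rightarrow> ('d \<Rightarrow> nat) \<Rightarrow> (real, 'd) vec" where
  "grid_point R k = (\<chi> l. real (k l) / real R)"

abbreviation grid :: "nat \<Rightarrow> ('d \<Rightarrow> nat) set" where
  "grid R \<equiv> Pi\<^sub>E UNIV (\<lambda>_. {..R})"

text \<open>This corner depends on the grid point only, yet lies to the left of the window of every
  \<open>x\<close> in the cell above that point, so finitely many families of dyadic boxes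
  suffice.\<close>

definition window_start :: "nat \<Rightarrow> real \<Rightarrow> nat \<Rightarrow> ('d \<Rightarrow> nat) \<Rightarrow> 'd \<Rightarrow> int" where
  "window_start n h R k l = \<lfloor>real n * (grid_point R k $ l - 2 * h)\<rfloor>"

text \<open>Division by \<open>C\<close> provides the bound 1 on weights that
  \<open>moment_inequality\<close> demands; the factor returns in
  \<open>kernel_weighted_sum_le\<close>.\<close>

definition grid_weight :: "nat \<Rightarrow> real \<Rightarrow> nat \<Rightarrow> ('d \<Rightarrow> nat) \<Rightarrow> (int, 'd) vec \<Rightarrow> real" where
  "grid_weight n h R k i = Kext (design_arg n h (grid_point R k) i) / C"

lemma abs_grid_weight_le: "\<bar>grid_weight n h R k i\<bar> \<le> 1"
  using Kext_bounds C_pos by (simp add: grid_weight_def)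

text \<open>A deterministic bound free of \<open>x\<close> on the right. The maximum over grid
  points is majorised by a sum of \<open>p\<close>-th powers, whose expectation is accessible. The
  last term is the cost of freezing the weight, as the argument of \<open>Kext\<close> moves by at
  most \<open>1 / (h R)\<close>.\<close>

lemma kernel_weighted_sum_le:
  fixes e :: "(int, 'd) vec \<Rightarrow> real"
  assumes h: "h > 0" and n: "n > 0" and R: "R > 0" "1 / real R \<le> h"
    and J: "4 * real n * h + 2 \<le> 2 ^ J" and p: "p > 0" and x: "x \<in> unit_cube"
  shows "\<bar>\<Sum>i\<in>Lam n. e i * K (design_arg n h x i)\<bar>
    \<le> C * (2 * (real J + 1)) ^ CARD('d) * (\<Sum>k\<in>grid R. \<Sum>f\<in>dyadic_boxes J.
          \<bar>\<Sum>i\<in>dyadic_box (window_start n h R k) f. grid_weight n h R k i * e i\<bar> powr p) powr (1 / p)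
      + \<eta> / (h * real R) * (\<Sum>i\<in>Lam n. \<bar>e i\<bar>)"
proof -
  have x01: "0 \<le> x $ l" "x $ l \<le> 1" for l using x by (auto simp: unit_cube_def)
  define k where "k l = nat \<lfloor>real R * x $ l\<rfloor>" for l
  have k_le: "real (k l) \<le> real R * x $ l" "real R * x $ l \<le> real (k l) + 1" for l
    using x01 [of l] unfolding k_def by (auto simp: of_nat_nat) 
  have kR: "k \<in> grid R"
  proof (rule PiE_I)
    fix l
    have "real R * x $ l \<le> real R * 1" using x01 by (intro mult_left_mono) auto
    with k_le(1) [of l] have "real (k l) \<le> real R" by simp
    then show "k l \<in> {..R}" by simp
  qed simp
  define z where "z = grid_point R k"
  have z: "z $ l \<le> x $ l" "x $ l \<le> z $ l + 1 / real R" for l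
    using k_le [of l] R by (auto simp: z_def grid_point_def field_simps)
  have nR: "real n * (1 / real R) \<le> real n * h" using R by (intro mult_left_mono) auto
  have nz: "real n * z $ l \<le> real n * x $ l" "real n * x $ l \<le> real n * z $ l + real n * h" for l
  proof -
    show "real n * z $ l \<le> real n * x $ l" using z by (intro mult_left_mono) auto
    have "real n * x $ l \<le> real n * (z $ l + 1 / real R)" using z by (intro mult_left_mono) auto
    then show "real n * x $ l \<le> real n * z $ l + real n * h" using nR by (simp add: distrib_left)
  qed
  define s where "s = window_start n h R k"
  have s: "real_of_int (s l) \<le> real n * z $ l - 2 * (real n * h)"
    "real n * z $ l - 2 * (real n * h) - 1 \<le> real_of_int (s l)" for l
    unfolding s_def window_start_def z_def [symmetric] right_diff_distrib by linarith+
  define lo where "lo l = max 1 \<lceil>real n * (x $ l - h)\<rceil>" for l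
  define hi where "hi l = min (int n) \<lfloor>real n * (x $ l + h)\<rfloor>" for l
  define u where "u l = nat (lo l - s l)" for l
  \<comment> \<open>The maximum with \<open>u l\<close> turns an empty window,
    \<open>hi l < lo l\<close>, into an empty interval and preserves
    \<open>u l \<le> v l\<close>.\<close>
  define v where "v l = max (u l) (nat (hi l + 1 - s l))" for l
  have xh: "real n * (x $ l - h) = real n * x $ l - real n * h" "real n * (x $ l + h) = real n * x $ l + real n * h" for l
    by (simp_all add: algebra_simps)
  have nh: "real n * h \<ge> 0" using h by simp
  have J': "4 * (real n * h) + 2 \<le> 2 ^ J" using J by simp
  have z0: "real n * z $ l \<ge> 0" for l by (simp add: z_def grid_point_def)
  have lo_s: "lo l \<ge> s l" for l
  proof -
    have "real_of_int (s l) \<le> real n * (x $ l - h)" using s(1) [of l] nz(1) [of l] nh xh by simp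
    then have "s l \<le> \<lceil>real n * (x $ l - h)\<rceil>" by linarith
    then show ?thesis by (simp add: lo_def)
  qed
  have u_le: "u l \<le> 2 ^ J" for l
  proof -
    have "real_of_int (lo l - s l) \<le> real_of_int (2 ^ J)"
    proof (cases "lo l = 1")
      case True
      then show ?thesis using s(2) [of l] nh J' z0 [of l] by simp
    next
      case False
      then have "lo l = \<lceil>real n * (x $ l - h)\<rceil>" by (simp add: lo_def max_def split: if_splits)
      then have "real_of_int (lo l) \<le> real n * (x $ l - h) + 1" using of_int_ceiling_le_add_one by metis
      then have "real_of_int (lo l) \<le> real n * x $ l - real n * h + 1" by (simp only: xh)
      then have "real_of_int (lo l) - real_of_int (s l) \<le> 2 ^ J"
        using s(2) [of l] nz(2) [of l] nh J' by linarith
      then show ?thesis by simp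
    qed
    then have "lo l - s l \<le> 2 ^ J" by (simp only: of_int_le_iff)
    then show ?thesis by (simp add: u_def nat_le_iff)
  qed
  have v_le: "v l \<le> 2 ^ J" for l
  proof -
    have "real_of_int (hi l) \<le> real n * (x $ l + h)" unfolding hi_def le_floor_iff [symmetric] by simp
    then have "real_of_int (hi l) \<le> real n * x $ l + real n * h" by (simp only: xh)
    \<comment> \<open>Origin of \<open>4 n h + 2\<close>: \<open>2 n h\<close> to the left of the
      grid point, \<open>n h\<close> for the cell and \<open>n h\<close> for the window to the
      right, one unit for the floor in \<open>s\<close> and one for the half-open end.\<close>
    then have "real_of_int (hi l) + 1 - real_of_int (s l) \<le> 2 ^ J"
      using s(2) [of l] nz(2) [of l] nh J' by linarith
    then have "real_of_int (hi l + 1 - s l) \<le> real_of_int (2 ^ J)" by simp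
    then have "hi l + 1 - s l \<le> 2 ^ J" by (simp only: of_int_le_iff)
    then show ?thesis using u_le by (simp add: v_def nat_le_iff)
  qed
  have uv: "u l \<le> v l" for l by (simp add: v_def)
  define B where "B = {i \<in> Lam n. maxnorm (design_arg n h x i) \<le> 1}"
  have interval: "t - s l \<in> {int (u l)..<int (v l)} \<longleftrightarrow> lo l \<le> t \<and> t \<le> hi l" for t l
    using lo_s [of l] by (auto simp: u_def v_def)
  have B: "B = {i. \<forall>l. i $ l - s l \<in> {int (u l)..<int (v l)}}"
    unfolding B_def interval maxnorm_design_arg_le [OF h n] Lam_def lo_def hi_def
    by (auto simp: ceiling_le_iff le_floor_iff)
  have w: "Kext (design_arg n h z i) = C * grid_weight n h R k i" for i
    using C_pos by (simp add: grid_weight_def z_def)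
  have diff: "\<bar>Kext (design_arg n h x i) - Kext (design_arg n h z i)\<bar> \<le> \<eta> / (h * real R)" for i
  proof -
    have "design_arg n h x i - design_arg n h z i = (1 / h) *\<^sub>R (x - z)"
      by (simp add: design_arg_def algebra_simps)
    moreover have "maxnorm ((1 / h) *\<^sub>R (x - z)) \<le> 1 / (h * real R)"
      unfolding maxnorm_le_iff
    proof
      fix l
      have "\<bar>x $ l - z $ l\<bar> \<le> 1 / real R" using z [of l] by (auto simp: abs_le_iff)
      then have "(1 / h) * \<bar>x $ l - z $ l\<bar> \<le> (1 / h) * (1 / real R)" using h by (intro mult_left_mono) auto
      then show "\<bar>((1 / h) *\<^sub>R (x - z)) $ l\<bar> \<le> 1 / (h * real R)" using h by (simp add: abs_mult)
    qed
    ultimately have "\<eta> * maxnorm (design_arg n h x i - design_arg n h z i) \<le> \<eta> * (1 / (h * real R))"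
      using \<eta>_pos by (intro mult_left_mono) auto
    then show ?thesis using Kext_lip [of "design_arg n h x i" "design_arg n h z i"] by simp
  qed
  let ?D = "\<lambda>k. \<Sum>f\<in>dyadic_boxes J. \<bar>\<Sum>i\<in>dyadic_box (window_start n h R k) f. grid_weight n h R k i * e i\<bar> powr p"
  have "(\<Sum>i\<in>Lam n. e i * K (design_arg n h x i)) = (\<Sum>i\<in>B. e i * Kext (design_arg n h x i))"
    using finite_Lam K_supp by (intro sum.mono_neutral_cong_right) (auto simp: B_def K_eq_Kext not_le)
  also have "\<dots> = C * (\<Sum>i\<in>B. grid_weight n h R k i * e i)
      + (\<Sum>i\<in>B. e i * (Kext (design_arg n h x i) - Kext (design_arg n h z i)))"
    by (simp add: w algebra_simps sum_distrib_left sum_subtractf)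
  also have "\<bar>\<dots>\<bar> \<le> C * \<bar>\<Sum>i\<in>B. grid_weight n h R k i * e i\<bar>
      + (\<Sum>i\<in>B. \<bar>e i\<bar> * \<bar>Kext (design_arg n h x i) - Kext (design_arg n h z i)\<bar>)"
    using C_pos by (intro order.trans [OF abs_triangle_ineq] add_mono order.trans [OF sum_abs]) (auto simp: abs_mult)
  also have "\<dots> \<le> C * ((2 * (real J + 1)) ^ CARD('d) * (\<Sum>k\<in>grid R. ?D k) powr (1 / p))
      + \<eta> / (h * real R) * (\<Sum>i\<in>Lam n. \<bar>e i\<bar>)"
  proof (intro add_mono mult_left_mono)
    have "\<bar>\<Sum>i\<in>B. grid_weight n h R k i * e i\<bar> \<le> (2 * (real J + 1)) ^ CARD('d) * ?D k powr (1 / p)"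
      unfolding B s_def [symmetric] by (intro box_sum_le uv v_le p)
    also have "\<dots> \<le> (2 * (real J + 1)) ^ CARD('d) * (\<Sum>k\<in>grid R. ?D k) powr (1 / p)"
      using p kR by (intro mult_left_mono powr_mono2 member_le_sum) (auto intro!: sum_nonneg finite_PiE)
    finally show "\<bar>\<Sum>i\<in>B. grid_weight n h R k i * e i\<bar> \<le> (2 * (real J + 1)) ^ CARD('d) * (\<Sum>k\<in>grid R. ?D k) powr (1 / p)" .
    have "(\<Sum>i\<in>B. \<bar>e i\<bar> * \<bar>Kext (design_arg n h x i) - Kext (design_arg n h z i)\<bar>) \<le> (\<Sum>i\<in>B. \<bar>e i\<bar> * (\<eta> / (h * real R)))"
      by (intro sum_mono mult_left_mono diff) auto
    also have "\<dots> \<le> (\<Sum>i\<in>Lam n. \<bar>e i\<bar> * (\<eta> / (h * real R)))"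
      using finite_Lam \<eta>_pos h by (intro sum_mono2) (auto simp: B_def)
    finally show "(\<Sum>i\<in>B. \<bar>e i\<bar> * \<bar>Kext (design_arg n h x i) - Kext (design_arg n h z i)\<bar>)
      \<le> \<eta> / (h * real R) * (\<Sum>i\<in>Lam n. \<bar>e i\<bar>)"
      by (simp add: sum_distrib_left mult.commute)
  qed (use C_pos in auto)
  finally show ?thesis by (simp add: mult.assoc)
qed

end

section \<open>The uniform rate\<close>

text \<open>Here \<open>N\<close> is \<open>n\<close>, \<open>X\<close> is \<open>n h\<close>, and
  \<open>N powr \<tau>\<close> bounds \<open>J + 1\<close>. The factors are the box decomposition
  over the denominator, the number of grid points, and the dyadic moments. The powers of
  \<open>X\<close> combine to \<open>- (d * p / 2)\<close>, as in the \<open>p\<close>-th power of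
  the rate.\<close>

lemma rate_identity:
  fixes N X p \<tau> \<kappa> :: real and d :: nat
  assumes N: "N > 0" and X: "X > 0"
  shows "((4 * N powr \<tau> / X) ^ d) powr p * (3 * N powr \<kappa>) ^ d * (2 * N powr \<tau> * (10 * X) powr (p / 2)) ^ d
    = ((4 ^ d) powr p * 3 ^ d * (2 * 10 powr (p / 2)) ^ d)
      * (N powr (\<tau> * (d * (p + 1)) + d * \<kappa>) * X powr (- (d * p / 2)))"
proof -
  have "((N powr \<tau>) ^ d) powr p * (N powr \<kappa>) ^ d * (N powr \<tau>) ^ d = N powr (\<tau> * (d * (p + 1)) + d * \<kappa>)"
    using N by (simp add: powr_powr powr_add [symmetric] algebra_simps flip: powr_realpow)
  moreover have "(X powr (p / 2)) ^ d / (X ^ d) powr p = X powr (- (d * p / 2))"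
    using X by (simp add: powr_powr powr_diff [symmetric] algebra_simps flip: powr_realpow)
  moreover have "((4 * N powr \<tau> / X) ^ d) powr p * (3 * N powr \<kappa>) ^ d * (2 * N powr \<tau> * (10 * X) powr (p / 2)) ^ d
    = ((4 ^ d) powr p * 3 ^ d * (2 * 10 powr (p / 2)) ^ d)
      * ((((N powr \<tau>) ^ d) powr p * (N powr \<kappa>) ^ d * (N powr \<tau>) ^ d) * ((X powr (p / 2)) ^ d / (X ^ d) powr p))"
    using N X by (simp add: power_mult_distrib power_divide powr_mult powr_divide)
  ultimately show ?thesis by simp
qed

locale fixed_design_regression =
  stationary_C3_field M eps p + kernel K \<eta> c C
  for M :: "'a measure" and eps :: "(int, 'd::{finite,linorder}) vec \<Rightarrow> 'a \<Rightarrow> real" and p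
    and K :: "(real, 'd) vec \<Rightarrow> real" and \<eta> c C +
  assumes mean0: "integrable M (eps 0)" "integral\<^sup>L M (eps 0) = 0"
begin

lemma eps_mean0: "integrable M (eps i)" "integral\<^sup>L M (eps i) = 0"
  using shift_one [of "\<lambda>x. x" i] mean0 by simp_all

text \<open>Zero mean identifies the expectation with the smoothed \<open>g\<close>, which centring
  then removes. If the kernel sum vanishes, both sides are 0 by the convention on division.\<close>

lemma gn_centered:
  "gn g eps K h n x \<omega> - integral\<^sup>L M (gn g eps K h n x)
    = (\<Sum>i\<in>Lam n. eps i \<omega> * K (design_arg n (h n) x i)) / (\<Sum>i\<in>Lam n. K (design_arg n (h n) x i))"
proof -
  let ?k = "\<lambda>i. K (design_arg n (h n) x i)" and ?g = "\<lambda>i. g ((1 / real n) *\<^sub>R ivec i)"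
  have gn: "gn g eps K h n x \<omega> = (\<Sum>i\<in>Lam n. ?g i * ?k i) / (\<Sum>i\<in>Lam n. ?k i)
      + (\<Sum>i\<in>Lam n. eps i \<omega> * ?k i) / (\<Sum>i\<in>Lam n. ?k i)" for \<omega>
    by (simp add: gn_def design_arg_def distrib_right sum.distrib add_divide_distrib)
  have "integral\<^sup>L M (gn g eps K h n x) = (\<Sum>i\<in>Lam n. ?g i * ?k i) / (\<Sum>i\<in>Lam n. ?k i)"
    unfolding gn [abs_def] using eps_mean0 by (simp add: prob_space)
  then show ?thesis by (simp add: gn)
qed

text \<open>\<open>d0\<close> bounds the denominator uniformly in \<open>x\<close>. The dyadic part
  of \<open>U\<close> carries all the cancellation; the freezing error is estimated crudely through
  \<open>n ^ d\<close> absolute values, because a large \<open>R\<close> can compensate.\<close>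

lemma sup_moment_le:
  assumes h: "h n > 0" "h n \<le> 1 / 2" and nh: "real n * h n \<ge> 2" and R: "R > 0" "1 / real R \<le> h n"
    and J: "4 * real n * h n + 2 \<le> 2 ^ J"
  defines "d0 \<equiv> c * (real n * h n / 2) ^ CARD('d)"
  shows "(\<integral>\<^sup>+\<omega>. ennreal (\<bar>SUP x\<in>unit_cube. \<bar>gn g eps K h n x \<omega> - integral\<^sup>L M (gn g eps K h n x)\<bar>\<bar> powr p) \<partial>M)
    \<le> ennreal (2 powr p * ((C * (2 * (real J + 1)) ^ CARD('d) / d0) powr p
          * (real (R + 1) ^ CARD('d) * (moment_const powr (p / 2) * (2 * (real J + 1) * (2 ^ J) powr (p / 2)) ^ CARD('d)))
        + (\<eta> / (h n * real R) * real n ^ CARD('d) / d0) powr p * eps_moment))"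
proof -
  have n: "n > 0" using nh by (cases n) auto
  have d0: "d0 > 0" using c_pos h n by (simp add: d0_def)
  define A where "A = C * (2 * (real J + 1)) ^ CARD('d)"
  define E0 where "E0 = \<eta> / (h n * real R)"
  define Z where "Z \<omega> = (\<Sum>k\<in>grid R. \<Sum>f\<in>dyadic_boxes J.
     \<bar>wsum (grid_weight n (h n) R k) (dyadic_box (window_start n (h n) R k) f) 0 \<omega>\<bar> powr p)" for \<omega>
  define U where "U \<omega> = A * Z \<omega> powr (1 / p) + E0 * (\<Sum>i\<in>Lam n. \<bar>eps i \<omega>\<bar>)" for \<omega>
  define H where "H \<omega> = 2 powr p * ((A / d0) powr p * Z \<omega>
    + (E0 / d0) powr p * (real (n ^ CARD('d)) powr (p - 1) * (\<Sum>i\<in>Lam n. \<bar>eps i \<omega>\<bar> powr p)))" for \<omega>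
  have A0: "A \<ge> 0" using C_pos by (simp add: A_def)
  have E00: "E0 \<ge> 0" using \<eta>_pos h by (simp add: E0_def)
  have Z0: "Z \<omega> \<ge> 0" for \<omega> by (auto simp: Z_def intro!: sum_nonneg)
  have pt: "\<bar>gn g eps K h n x \<omega> - integral\<^sup>L M (gn g eps K h n x)\<bar> \<le> U \<omega> / d0" if x: "x \<in> unit_cube" for x \<omega>
  proof -
    have den: "d0 \<le> (\<Sum>i\<in>Lam n. K (design_arg n (h n) x i))"
      unfolding d0_def by (rule kernel_sum_ge [OF h nh x])
    have "\<bar>\<Sum>i\<in>Lam n. eps i \<omega> * K (design_arg n (h n) x i)\<bar> \<le> U \<omega>"
      using kernel_weighted_sum_le [OF h(1) n R J _ x, of p "\<lambda>i. eps i \<omega>"] p_gt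
      by (simp add: U_def A_def E0_def Z_def wsum_def)
    then show ?thesis
      unfolding gn_centered abs_divide using den d0 by (intro frac_le) auto
  qed
  have ne: "unit_cube \<noteq> ({} :: (real, 'd) vec set)"
  proof -
    have "(0 :: (real, 'd) vec) \<in> unit_cube" by (simp add: unit_cube_def)
    then show ?thesis by blast
  qed
  have sup: "\<bar>SUP x\<in>unit_cube. \<bar>gn g eps K h n x \<omega> - integral\<^sup>L M (gn g eps K h n x)\<bar>\<bar> \<le> U \<omega> / d0" for \<omega>
  proof -
    have le: "(SUP x\<in>unit_cube. \<bar>gn g eps K h n x \<omega> - integral\<^sup>L M (gn g eps K h n x)\<bar>) \<le> U \<omega> / d0"
      using ne pt by (intro cSUP_least) auto
    obtain x0 :: "(real, 'd) vec" where "x0 \<in> unit_cube" using ne by blast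
    have "0 \<le> \<bar>gn g eps K h n x0 \<omega> - integral\<^sup>L M (gn g eps K h n x0)\<bar>" by simp
    \<comment> \<open>For fixed \<open>\<omega>\<close> the bound \<open>U / d0\<close> makes the
      family bounded, without which a real-valued \<open>SUP\<close> need not be an upper
      bound.\<close>
    also have "\<dots> \<le> (SUP x\<in>unit_cube. \<bar>gn g eps K h n x \<omega> - integral\<^sup>L M (gn g eps K h n x)\<bar>)"
      by (rule cSUP_upper [OF \<open>x0 \<in> unit_cube\<close>]) (use pt in \<open>auto intro!: bdd_aboveI2\<close>)
    finally show ?thesis using le by simp
  qed
  have UH: "(U \<omega> / d0) powr p \<le> H \<omega>" for \<omega>
  proof -
    let ?S = "\<Sum>i\<in>Lam n. \<bar>eps i \<omega>\<bar>"
    have S0: "?S \<ge> 0" by (intro sum_nonneg) auto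
    have "(U \<omega> / d0) powr p = (A / d0 * Z \<omega> powr (1 / p) + E0 / d0 * ?S) powr p"
      by (simp add: U_def add_divide_distrib)
    also have "\<dots> \<le> 2 powr p * ((A / d0 * Z \<omega> powr (1 / p)) powr p + (E0 / d0 * ?S) powr p)"
      using p_gt A0 E00 d0 S0 by (intro add_powr_le mult_nonneg_nonneg) auto
    also have "(A / d0 * Z \<omega> powr (1 / p)) powr p = (A / d0) powr p * Z \<omega>"
      using powr_mult [of "A / d0" "Z \<omega> powr (1 / p)" p] A0 d0 p_gt Z0 [of \<omega>] by (simp only: powr_powr) simp
    also have "(E0 / d0 * ?S) powr p = (E0 / d0) powr p * ?S powr p"
      by (rule powr_mult)
    also have "?S powr p \<le> real (n ^ CARD('d)) powr (p - 1) * (\<Sum>i\<in>Lam n. \<bar>eps i \<omega>\<bar> powr p)"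
      using sum_powr_le [OF _ finite_Lam, of p n "\<lambda>i. \<bar>eps i \<omega>\<bar>"] p_gt by (simp add: card_Lam)
    finally show ?thesis unfolding H_def by (simp add: mult_left_mono)
  qed
  have Zint: "integrable M Z" unfolding Z_def [abs_def]
    by (intro Bochner_Integration.integrable_sum [of "grid R"] dyadic_moment abs_grid_weight_le)
  have EZ: "integral\<^sup>L M Z \<le> real (R + 1) ^ CARD('d) * (moment_const powr (p / 2) * (2 * (real J + 1) * (2 ^ J) powr (p / 2)) ^ CARD('d))"
  proof -
    have "integral\<^sup>L M Z = (\<Sum>k\<in>grid R. \<integral>\<omega>. (\<Sum>f\<in>dyadic_boxes J.
     \<bar>wsum (grid_weight n (h n) R k) (dyadic_box (window_start n (h n) R k) f) 0 \<omega>\<bar> powr p) \<partial>M)"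
      unfolding Z_def [abs_def]
      by (intro Bochner_Integration.integral_sum dyadic_moment abs_grid_weight_le)
    also have "\<dots> \<le> (\<Sum>k\<in>grid R. moment_const powr (p / 2) * (2 * (real J + 1) * (2 ^ J) powr (p / 2)) ^ CARD('d))"
      by (intro sum_mono dyadic_moment abs_grid_weight_le)
    finally show ?thesis by (simp add: card_PiE add.commute)
  qed
  have Hint: "integrable M H" unfolding H_def [abs_def] using Zint eps_Lp by auto
  have "integral\<^sup>L M H = 2 powr p * ((A / d0) powr p * integral\<^sup>L M Z
    + (E0 / d0) powr p * (real (n ^ CARD('d)) powr (p - 1) * (\<Sum>i\<in>(Lam n :: (int, 'd) vec set). eps_moment)))"
    unfolding H_def [abs_def] using Zint eps_Lp by (simp add: eps_moment)
  also have "real (n ^ CARD('d)) powr (p - 1) * (\<Sum>i\<in>(Lam n :: (int, 'd) vec set). eps_moment)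
      = (real n ^ CARD('d)) powr p * eps_moment"
    using powr_pred_mult [of "real n ^ CARD('d)" p] by (simp add: card_Lam mult.assoc [symmetric])
  also have "(E0 / d0) powr p * ((real n ^ CARD('d)) powr p * eps_moment) = (E0 * real n ^ CARD('d) / d0) powr p * eps_moment"
    using E00 d0 powr_mult [of "E0 / d0" "real n ^ CARD('d)" p] by (simp add: mult_ac)
  also have "2 powr p * ((A / d0) powr p * integral\<^sup>L M Z + (E0 * real n ^ CARD('d) / d0) powr p * eps_moment)
    \<le> 2 powr p * ((A / d0) powr p * (real (R + 1) ^ CARD('d) * (moment_const powr (p / 2) * (2 * (real J + 1) * (2 ^ J) powr (p / 2)) ^ CARD('d)))
        + (E0 * real n ^ CARD('d) / d0) powr p * eps_moment)"
    by (intro mult_left_mono add_mono EZ order_refl) auto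
  finally have EH: "integral\<^sup>L M H \<le> 2 powr p * ((A / d0) powr p * (real (R + 1) ^ CARD('d) * (moment_const powr (p / 2) * (2 * (real J + 1) * (2 ^ J) powr (p / 2)) ^ CARD('d)))
        + (E0 * real n ^ CARD('d) / d0) powr p * eps_moment)" .
  \<comment> \<open>Domination by the integrable \<open>H\<close> and monotonicity of the
    nonnegative integral bypass the measurability of a supremum over uncountably many
    points.\<close>
  have "(\<integral>\<^sup>+\<omega>. ennreal (\<bar>SUP x\<in>unit_cube. \<bar>gn g eps K h n x \<omega> - integral\<^sup>L M (gn g eps K h n x)\<bar>\<bar> powr p) \<partial>M)
    \<le> (\<integral>\<^sup>+\<omega>. ennreal (H \<omega>) \<partial>M)"
    using p_gt by (intro nn_integral_mono ennreal_leI order.trans [OF _ UH] powr_mono2 sup) auto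
  also have "\<dots> = ennreal (integral\<^sup>L M H)"
    using order.trans [OF powr_ge_zero UH] by (intro nn_integral_eq_integral Hint) auto
  also have "\<dots> \<le> ennreal (2 powr p * ((A / d0) powr p * (real (R + 1) ^ CARD('d) * (moment_const powr (p / 2) * (2 * (real J + 1) * (2 ^ J) powr (p / 2)) ^ CARD('d)))
        + (E0 * real n ^ CARD('d) / d0) powr p * eps_moment))"
    by (intro ennreal_leI EH)
  finally show ?thesis by (simp add: A_def E0_def)
qed

definition rate_const :: real where
  "rate_const = 2 powr p * ((C / c) powr p * moment_const powr (p / 2)
      * ((4 ^ CARD('d)) powr p * 3 ^ CARD('d) * (2 * 10 powr (p / 2)) ^ CARD('d))
    + (\<eta> * 2 ^ CARD('d) / c) powr p * eps_moment)"

lemma rate_const_nonneg: "rate_const \<ge> 0"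
  unfolding rate_const_def by (auto intro!: mult_nonneg_nonneg add_nonneg_nonneg eps_moment_nonneg)

text \<open>The conditions on \<open>\<kappa>\<close> say that the mesh is at most \<open>h\<close>
  and that the freezing error, of order \<open>1 / (R h ^ (d + 1))\<close>, is at most of the order
  of the rate. In the condition on \<open>\<tau>\<close>, the power \<open>d * (p + 1)\<close> of
  \<open>J + 1\<close> is \<open>d * p\<close> from the box decomposition plus \<open>d\<close> from
  the dyadic moments; \<open>d * \<kappa>\<close> is the exponent of the grid size.\<close>

lemma sup_moment_rate:
  fixes h :: "nat \<Rightarrow> real"
  defines "d \<equiv> real CARD('d)"
  assumes h: "h n > 0" "h n \<le> 1 / 2" and nh: "real n * h n \<ge> 2"
    and R: "real n powr \<kappa> \<le> real R" "real R + 1 \<le> 3 * real n powr \<kappa>"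
    and \<kappa>: "real n powr (- \<kappa>) \<le> h n" "real n powr (- \<kappa>) \<le> real n powr (a - d / 2) * h n powr (d / 2 + 1)"
    and J: "4 * real n * h n + 2 \<le> 2 ^ J" "2 ^ J \<le> 10 * (real n * h n)" "real J + 1 \<le> real n powr \<tau>"
    and \<tau>: "\<tau> * (d * (p + 1)) + d * \<kappa> \<le> a * p"
  shows "(\<integral>\<^sup>+\<omega>. ennreal (\<bar>SUP x\<in>unit_cube. \<bar>gn g eps K h n x \<omega> - integral\<^sup>L M (gn g eps K h n x)\<bar>\<bar> powr p) \<partial>M)
    \<le> ennreal (rate_const * (real n powr a / (real n * h n) powr (d / 2)) powr p)"
proof -
  have n: "n > 0" using nh by (cases n) auto
  define N where "N = real n"
  define X where "X = N * h n"
  have N: "N \<ge> 1" using n by (simp add: N_def)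
  have X: "X > 0" using N h by (simp add: X_def)
  define v where "v = N powr a / X powr (d / 2)"
  have v: "v powr p = N powr (a * p) * X powr (- (d * p / 2))"
    using N X by (simp add: v_def powr_divide powr_powr powr_minus field_simps)
  define d0 where "d0 = c * (X / 2) ^ CARD('d)"
  have d0: "d0 > 0" using c_pos X by (simp add: d0_def)
  have Rpos: "real R > 0" using R(1) n by (smt (verit) of_nat_0_less_iff powr_gt_zero)
  have invR: "1 / real R \<le> N powr (- \<kappa>)"
    using R(1) n by (simp add: powr_minus N_def inverse_eq_divide frac_le)
  have t1: "(C * (2 * (real J + 1)) ^ CARD('d) / d0) powr p
          * (real (R + 1) ^ CARD('d) * (moment_const powr (p / 2) * (2 * (real J + 1) * (2 ^ J) powr (p / 2)) ^ CARD('d)))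
      \<le> (C / c) powr p * moment_const powr (p / 2)
      * ((4 ^ CARD('d)) powr p * 3 ^ CARD('d) * (2 * 10 powr (p / 2)) ^ CARD('d)) * v powr p"
  proof -
    have "C * (2 * (real J + 1)) ^ CARD('d) / d0 \<le> C * (2 * N powr \<tau>) ^ CARD('d) / d0"
      using J(3) C_pos d0 by (intro divide_right_mono mult_left_mono power_mono) (auto simp: N_def)
    also have "\<dots> = C / c * (4 * N powr \<tau> / X) ^ CARD('d)"
    proof -
      have "4 * N powr \<tau> / X = (2 * N powr \<tau>) / (X / 2)" by simp
      then have "(4 * N powr \<tau> / X) ^ CARD('d) = (2 * N powr \<tau>) ^ CARD('d) / (X / 2) ^ CARD('d)"
        by (simp only: power_divide)
      then show ?thesis by (simp add: d0_def)
    qed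
    finally have "(C * (2 * (real J + 1)) ^ CARD('d) / d0) powr p \<le> (C / c * (4 * N powr \<tau> / X) ^ CARD('d)) powr p"
      using p_gt C_pos d0 by (intro powr_mono2) auto
    also have "\<dots> = (C / c) powr p * ((4 * N powr \<tau> / X) ^ CARD('d)) powr p"
      by (rule powr_mult)
    finally have a1: "(C * (2 * (real J + 1)) ^ CARD('d) / d0) powr p \<le> (C / c) powr p * ((4 * N powr \<tau> / X) ^ CARD('d)) powr p" .
    have a2: "real (R + 1) ^ CARD('d) \<le> (3 * N powr \<kappa>) ^ CARD('d)"
      using R(2) by (intro power_mono) (auto simp: N_def add.commute)
    have a3: "(2 * (real J + 1) * (2 ^ J) powr (p / 2)) ^ CARD('d) \<le> (2 * N powr \<tau> * (10 * X) powr (p / 2)) ^ CARD('d)"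
      using J(2,3) p_gt by (intro power_mono mult_mono powr_mono2) (auto simp: N_def X_def)
    have "(C * (2 * (real J + 1)) ^ CARD('d) / d0) powr p
          * (real (R + 1) ^ CARD('d) * (moment_const powr (p / 2) * (2 * (real J + 1) * (2 ^ J) powr (p / 2)) ^ CARD('d)))
       \<le> ((C / c) powr p * ((4 * N powr \<tau> / X) ^ CARD('d)) powr p)
          * ((3 * N powr \<kappa>) ^ CARD('d) * (moment_const powr (p / 2) * (2 * N powr \<tau> * (10 * X) powr (p / 2)) ^ CARD('d)))"
      by (intro mult_mono a1 a2 a3 order_refl mult_nonneg_nonneg zero_le_power) auto
    also have "\<dots> = (C / c) powr p * moment_const powr (p / 2) *
        (((4 * N powr \<tau> / X) ^ CARD('d)) powr p * (3 * N powr \<kappa>) ^ CARD('d) * (2 * N powr \<tau> * (10 * X) powr (p / 2)) ^ CARD('d))"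
      by (simp only: mult_ac)
    also have "\<dots> = (C / c) powr p * moment_const powr (p / 2) *
       (((4 ^ CARD('d)) powr p * 3 ^ CARD('d) * (2 * 10 powr (p / 2)) ^ CARD('d))
      * (N powr (\<tau> * (d * (p + 1)) + d * \<kappa>) * X powr (- (d * p / 2))))"
      unfolding d_def using N X by (subst rate_identity) auto
    also have "\<dots> \<le> (C / c) powr p * moment_const powr (p / 2) *
       (((4 ^ CARD('d)) powr p * 3 ^ CARD('d) * (2 * 10 powr (p / 2)) ^ CARD('d)) * (v powr p))"
      unfolding v using N \<tau> by (intro mult_left_mono mult_right_mono powr_mono) auto
    finally show ?thesis by (simp only: mult.assoc)
  qed
  have t2: "(\<eta> / (h n * real R) * real n ^ CARD('d) / d0) powr p * eps_moment
     \<le> (\<eta> * 2 ^ CARD('d) / c) powr p * eps_moment * v powr p"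
  proof -
    have "\<eta> / (h n * real R) * real n ^ CARD('d) / d0 = (\<eta> * 2 ^ CARD('d) / c) * (1 / real R / (h n * h n ^ CARD('d)))"
      using n h c_pos by (simp add: d0_def X_def N_def power_divide power_mult_distrib field_simps)
    also have "1 / real R / (h n * h n ^ CARD('d)) \<le> N powr (a - d / 2) * h n powr (d / 2 + 1) / (h n * h n ^ CARD('d))"
      using invR \<kappa>(2) h by (intro divide_right_mono) (auto simp: N_def)
    also have "\<dots> = v"
    proof -
      have "h n * h n ^ CARD('d) = h n powr (1 + d)"
        using h by (simp add: powr_add powr_realpow d_def)
      then have "N powr (a - d / 2) * h n powr (d / 2 + 1) / (h n * h n ^ CARD('d)) = N powr (a - d / 2) * (h n powr (d / 2 + 1) / h n powr (1 + d))"
        by simp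
      also have "h n powr (d / 2 + 1) / h n powr (1 + d) = h n powr (- (d / 2))"
        by (simp add: powr_diff [symmetric])
      also have "N powr (a - d / 2) * h n powr (- (d / 2)) = v"
        unfolding v_def X_def powr_mult powr_diff powr_minus
        by (simp only: divide_inverse inverse_mult_distrib mult.assoc)
      finally show ?thesis .
    qed
    finally have "\<eta> / (h n * real R) * real n ^ CARD('d) / d0 \<le> (\<eta> * 2 ^ CARD('d) / c) * v"
      using \<eta>_pos c_pos by (simp add: mult_left_mono divide_right_mono)
    then have "(\<eta> / (h n * real R) * real n ^ CARD('d) / d0) powr p \<le> ((\<eta> * 2 ^ CARD('d) / c) * v) powr p"
      using p_gt \<eta>_pos h d0 by (intro powr_mono2) auto
    also have "\<dots> = (\<eta> * 2 ^ CARD('d) / c) powr p * v powr p"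
      by (rule powr_mult)
    finally have "(\<eta> / (h n * real R) * real n ^ CARD('d) / d0) powr p * eps_moment
      \<le> (\<eta> * 2 ^ CARD('d) / c) powr p * v powr p * eps_moment"
      using eps_moment_nonneg by (rule mult_right_mono)
    then show ?thesis by (simp only: mult_ac)
  qed
  have "1 / real R \<le> h n" using invR \<kappa>(1) by (simp add: N_def)
  then have "(\<integral>\<^sup>+\<omega>. ennreal (\<bar>SUP x\<in>unit_cube. \<bar>gn g eps K h n x \<omega> - integral\<^sup>L M (gn g eps K h n x)\<bar>\<bar> powr p) \<partial>M)
    \<le> ennreal (2 powr p * ((C * (2 * (real J + 1)) ^ CARD('d) / d0) powr p
          * (real (R + 1) ^ CARD('d) * (moment_const powr (p / 2) * (2 * (real J + 1) * (2 ^ J) powr (p / 2)) ^ CARD('d)))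
        + (\<eta> / (h n * real R) * real n ^ CARD('d) / d0) powr p * eps_moment))"
    unfolding d0_def X_def N_def using Rpos by (intro sup_moment_le h nh J(1)) auto
  also have "\<dots> \<le> ennreal (2 powr p * ((C / c) powr p * moment_const powr (p / 2)
      * ((4 ^ CARD('d)) powr p * 3 ^ CARD('d) * (2 * 10 powr (p / 2)) ^ CARD('d)) * v powr p
      + (\<eta> * 2 ^ CARD('d) / c) powr p * eps_moment * v powr p))"
    by (intro ennreal_leI mult_left_mono add_mono t1 t2) auto
  also have "\<dots> = ennreal (rate_const * v powr p)"
    by (simp add: rate_const_def distrib_left distrib_right mult.assoc)
  finally show ?thesis by (simp add: v_def X_def N_def)
qed

end

theorem theorem2:
  fixes M :: "'a measure"
    and eps :: "(int, 'd::{finite,linorder}) vec \<Rightarrow> 'a \<Rightarrow> real"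
    and g :: "(real, 'd) vec \<Rightarrow> real"
    and K :: "(real, 'd) vec \<Rightarrow> real"
    and h :: "nat \<Rightarrow> real"
    and p a :: real
  assumes "prob_space M"
    and meas: "\<And>j. eps j \<in> borel_measurable M"
    and stationary: "\<And>k I. finite I \<Longrightarrow>
        distr M (Pi\<^sub>M I (\<lambda>_. borel)) (\<lambda>\<omega>. restrict (\<lambda>i. eps (i + k) \<omega>) I)
      = distr M (Pi\<^sub>M I (\<lambda>_. borel)) (\<lambda>\<omega>. restrict (\<lambda>i. eps i \<omega>) I)"
    and mean0: "integrable M (eps 0)" "integral\<^sup>L M (eps 0) = 0"
    \<comment> \<open>K is a probability density on R^d\<close>
    and K_nonneg: "\<And>x. K x \<ge> 0"
    and K_int: "integrable lborel K" "integral\<^sup>L lborel K = 1"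
    \<comment> \<open>(A1)\<close>
    and K_sym: "\<And>x. K (- x) = K x"
    and K_supp: "\<And>x. maxnorm x > 1 \<Longrightarrow> K x = 0"
    and K_lip: "\<exists>\<eta>>0. \<forall>x y. maxnorm x \<le> 1 \<longrightarrow> maxnorm y \<le> 1 \<longrightarrow>
                  \<bar>K x - K y\<bar> \<le> \<eta> * maxnorm (x - y)"
    and K_bounds: "\<exists>c C. c > 0 \<and> C > 0 \<and> (\<forall>x. maxnorm x \<le> 1 \<longrightarrow> c \<le> K x \<and> K x \<le> C)"
    \<comment> \<open>bandwidth\<close>
    and h_pos: "\<And>n. h n > 0"
    and h_lim: "h \<longlonglongrightarrow> 0"
    and nh_lim: "filterlim (\<lambda>n. real n * h n) at_top sequentially"
    \<comment> \<open>(C3) for p > 2\<close>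
    and p_gt: "p > 2"
    and Lp: "integrable M (\<lambda>\<omega>. \<bar>eps 0 \<omega>\<bar> powr p)"
    and C3: "(\<Sum>\<^sub>\<infinity> k\<in>Vset 0 1.
               Lpnorm M (p / 2) (\<lambda>\<omega>. eps k \<omega> * real_cond_exp M (Fsig M eps (Vset 0 (imax k))) (eps 0) \<omega>))
             < \<infinity>"
    and a_pos: "a > 0"
    and theta_pos: "(2 * a * (CARD('d) + p) - CARD('d)^2) / (CARD('d) * (3 * CARD('d) + 2)) > 0"
    and h_ge: "\<And>n. n \<ge> 1 \<Longrightarrow>
       h n \<ge> real n powr (- ((2 * a * (CARD('d) + p) - CARD('d)^2) / (CARD('d) * (3 * CARD('d) + 2))))"
  shows "\<exists>C. \<forall>\<^sub>F n in sequentially.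
     Lpnorm M p (\<lambda>\<omega>. SUP x\<in>unit_cube.
        \<bar>gn g eps K h n x \<omega> - integral\<^sup>L M (gn g eps K h n x)\<bar>)
     \<le> ennreal (C * (real n powr a / (real n * h n) powr (real CARD('d) / 2)))"
proof -
  define d where "d = real CARD('d)"
  define \<theta> where "\<theta> = (2 * a * (d + p) - d\<^sup>2) / (d * (3 * d + 2))"
  have d: "d \<ge> 1" by (simp add: d_def Suc_leI)
  have \<theta>_eq: "(2 * a * (CARD('d) + p) - CARD('d)^2) / (CARD('d) * (3 * CARD('d) + 2)) = \<theta>"
    by (simp add: \<theta>_def d_def distrib_left mult.commute)
  have \<theta>: "\<theta> > 0" using theta_pos unfolding \<theta>_eq .
  have h_ge': "real n powr (- \<theta>) \<le> h n" if "n \<ge> 1" for n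
    using h_ge [OF that] unfolding \<theta>_eq .
  have \<theta>_mult: "d * \<theta> * (3 * d + 2) = 2 * a * (d + p) - d\<^sup>2"
    using d by (simp add: \<theta>_def)
  obtain \<eta> where \<eta>: "\<eta> > 0" "\<And>x y. maxnorm x \<le> 1 \<Longrightarrow> maxnorm y \<le> 1 \<Longrightarrow> \<bar>K x - K y\<bar> \<le> \<eta> * maxnorm (x - y)"
    using K_lip by blast
  obtain c C where cC: "c > 0" "C > 0" "\<And>x. maxnorm x \<le> 1 \<Longrightarrow> c \<le> K x \<and> K x \<le> C"
    using K_bounds by blast
  interpret prob_space M by fact
  interpret fixed_design_regression M eps p K \<eta> c C
    by unfold_locales (fact meas stationary p_gt Lp C3 K_nonneg K_supp \<eta> cC mean0)+

  \<comment> \<open>The smallest exponent meeting both demands when \<open>h\<close> is as small as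
    \<open>n powr - \<theta>\<close>.\<close>
  define \<kappa> where "\<kappa> = max \<theta> (\<theta> * (d / 2 + 1) + d / 2 - a)"
  have \<kappa>_pos: "\<kappa> > 0" using \<theta> by (simp add: \<kappa>_def)
  have \<kappa>_lt: "d * \<kappa> < a * p"
  proof -
    have "d * \<theta> * (3 * d + 2) < a * p * (3 * d + 2)"
    proof -
      have "2 * (a * d) \<le> a * d * (3 * p)" using a_pos d p_gt by (intro order.trans [OF _ mult_left_mono [of 2 "3 * p"]]) auto
      moreover have "d\<^sup>2 > 0" using d by simp
      moreover have "a * p * (3 * d + 2) = 2 * a * (d + p) - d\<^sup>2 + (a * d * (3 * p) - 2 * (a * d)) + d\<^sup>2"
        by (simp add: algebra_simps)
      ultimately show ?thesis unfolding \<theta>_mult by linarith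
    qed
    then have 1: "d * \<theta> < a * p" using d by (simp add: mult_less_cancel_right)
    \<comment> \<open>This is the difference between the factors \<open>3 * d + 2\<close> and
      \<open>d + 2\<close>, each multiplied by \<open>d * \<theta>\<close>; it makes the inequality
      for the second entry of the maximum strict.\<close>
    have "2 * d * (d * \<theta>) > 0" using d \<theta> by simp
    then have "d * \<theta> * (d + 2) < 2 * a * (d + p) - d\<^sup>2"
      unfolding \<theta>_mult [symmetric] by (simp add: algebra_simps)
    then have 2: "d * (\<theta> * (d / 2 + 1) + d / 2 - a) < a * p"
      by (simp add: algebra_simps power2_eq_square)
    show ?thesis using 1 2 by (simp add: \<kappa>_def max_def)
  qed
  \<comment> \<open>Spends the whole gap between \<open>d * \<kappa>\<close> and
    \<open>a * p\<close> on the logarithms, which any positive exponent eventually absorbs.\<close>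
  define \<tau> where "\<tau> = (a * p - d * \<kappa>) / (d * (p + 1))"
  have \<tau>_pos: "\<tau> > 0" using \<kappa>_lt d p_gt by (simp add: \<tau>_def)
  have \<tau>: "\<tau> * (d * (p + 1)) + d * \<kappa> \<le> a * p" using d p_gt by (simp add: \<tau>_def)

  have "\<forall>\<^sub>F n in sequentially. h n < 1 / 2"
    using h_lim by (rule order_tendstoD) simp
  moreover have "\<forall>\<^sub>F n in sequentially. real n * h n \<ge> 2"
    using nh_lim by (simp add: filterlim_at_top)
  moreover have "\<forall>\<^sub>F n in sequentially. log 2 (4 * real n + 2) + 2 \<le> real n powr \<tau>"
    using \<tau>_pos by real_asymp
  ultimately have "\<forall>\<^sub>F n in sequentially.
     Lpnorm M p (\<lambda>\<omega>. SUP x\<in>unit_cube. \<bar>gn g eps K h n x \<omega> - integral\<^sup>L M (gn g eps K h n x)\<bar>)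
     \<le> ennreal (rate_const powr (1 / p) * (real n powr a / (real n * h n) powr (d / 2)))"
  proof eventually_elim
    case (elim n)
    have n: "n \<ge> 1" using elim(2) by (cases n) auto
    define v where "v = real n powr a / (real n * h n) powr (d / 2)"
    have v: "v \<ge> 0" by (simp add: v_def)
    \<comment> \<open>Rounding up and the extra grid point per coordinate add at most 2 to
      \<open>n powr \<kappa> \<ge> 1\<close>, hence the factor 3.\<close>
    define R where "R = nat \<lceil>real n powr \<kappa>\<rceil>"
    have n\<kappa>: "1 \<le> real n powr \<kappa>" using n \<kappa>_pos by (simp add: ge_one_powr_ge_zero)
    have R: "real n powr \<kappa> \<le> real R" "real R + 1 \<le> 3 * real n powr \<kappa>"
      using n\<kappa> unfolding R_def by linarith+
    define X where "X = 4 * real n * h n + 2"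
    define J where "J = nat \<lceil>log 2 X\<rceil>"
    \<comment> \<open>\<open>n h \<ge> 2\<close> absorbs the additive 2 and gives 5; rounding
      \<open>X\<close> up to a power of two doubles it, which is the 10 required by
      \<open>sup_moment_rate\<close>.\<close>
    have X: "X \<ge> 10" "X \<le> 4 * real n + 2" "X \<le> 5 * (real n * h n)"
      using elim(1,2) n h_pos [of n] by (auto simp: X_def)
    have lX: "log 2 X \<ge> 0" using X by simp
    have J1: "log 2 X \<le> real J" "real J \<le> log 2 X + 1" using lX unfolding J_def by linarith+
    have JX: "X \<le> 2 ^ J"
      using J1(1) X by (simp add: log_le_iff powr_realpow)
    have "2 powr real J \<le> 2 powr (log 2 X + 1)" using J1(2) by simp
    also have "\<dots> = 2 * X" using X by (simp add: powr_add)
    finally have J2: "2 ^ J \<le> 10 * (real n * h n)" using X(3) by (simp add: powr_realpow)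
    have "log 2 X \<le> log 2 (4 * real n + 2)" using X by simp
    then have J3: "real J + 1 \<le> real n powr \<tau>" using J1(2) elim(3) by linarith
    have k1: "real n powr (- \<kappa>) \<le> h n"
      using powr_mono [of "- \<kappa>" "- \<theta>" "real n"] h_ge' [OF n] n by (simp add: \<kappa>_def)
    have k2: "real n powr (- \<kappa>) \<le> real n powr (a - d / 2) * h n powr (d / 2 + 1)"
    proof -
      have "real n powr (- \<kappa>) \<le> real n powr ((a - d / 2) + (- \<theta>) * (d / 2 + 1))"
        using n by (intro powr_mono) (auto simp: \<kappa>_def algebra_simps)
      also have "\<dots> = real n powr (a - d / 2) * (real n powr (- \<theta>)) powr (d / 2 + 1)"
        unfolding powr_powr by (rule powr_add)
      also have "\<dots> \<le> real n powr (a - d / 2) * h n powr (d / 2 + 1)"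
        using h_ge' [OF n] d by (intro mult_left_mono powr_mono2) auto
      finally show ?thesis .
    qed
    let ?I = "\<integral>\<^sup>+\<omega>. ennreal (\<bar>SUP x\<in>unit_cube. \<bar>gn g eps K h n x \<omega> - integral\<^sup>L M (gn g eps K h n x)\<bar>\<bar> powr p) \<partial>M"
    have I: "?I \<le> ennreal (rate_const * v powr p)"
      unfolding v_def d_def
      using elim h_pos [of n] R k1 k2 JX J2 J3 \<tau>
      by (intro sup_moment_rate [where R = R and J = J and \<kappa> = \<kappa> and \<tau> = \<tau>]) (auto simp: d_def X_def)
    \<comment> \<open>Selects the finite branch in the definition of \<open>Lpnorm\<close>.\<close>
    then have fin: "?I \<noteq> \<infinity>" by (auto simp: top_unique)
    have "enn2real ?I \<le> rate_const * v powr p"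
      using enn2real_mono [OF I] rate_const_nonneg by simp
    then have "enn2real ?I powr (1 / p) \<le> (rate_const * v powr p) powr (1 / p)"
      using p_gt by (intro powr_mono2) auto
    also have "\<dots> = rate_const powr (1 / p) * v"
      using p_gt v by (simp add: powr_mult powr_powr)
    finally show ?case
      using fin by (simp add: Lpnorm_def Let_def v_def ennreal_leI)
  qed
  then show ?thesis unfolding d_def by blast
qed

end
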